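(* For every $n\in\mathbb N$, as formal power series in $X$ with coefficients in $\mathbb Z[Y,\mathbf x]$, \[ \mathsf H_n(Y;\mathbf x,X)\,(1-X)=\mathsf{HLS}_n\bigl(Y,(\mathbf x_CX)_{\varnothing\neq C\subseteq[n]}\bigr). \] In particular $\mathsf H_n(Y;\mathbf x,X)=\mathsf H^{\mathrm{num}}_n(Y,\mathbf x,X)/\prod_{I\subseteq[n]}(1-\mathbf x_IX)$ with \[ \mathsf H^{\mathrm{num}}_n(Y,\mathbf x,X)=\sum_{T\in\mathrm{rSSYT}_n}\Phi_T(Y)\prod_{C\in T}\mathbf x_CX\prod_{\varnothing\neq I\subseteq[n],\,I\notin T}(1-\mathbf x_IX)\in\mathbb Z[Y,\mathbf x,X]. \] (Taking $Y=q^{-1}$, $\mathsf H_n$ is Macdonald's Fourier-transformed Hecke series for $\mathrm{GSp}_{2n}$ over a local field with residue cardinality $q$.)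
   Context: Hall–Littlewood–Schubert series: Let $[n]=\{1,\dots,n\}$. $\mathrm{SSYT}_n$ is the set of semistandard Young tableaux with entries in $[n]$ (including the empty one); a tableau is identified with its sequence of columns $(C_1,\dots,C_\ell)$, $C_j\subseteq[n]$ the set of entries of column $j$, and $T_{ij}$ is the entry in row $i$, column $j$. $T$ is reduced if its columns are pairwise distinct; $\mathrm{rSSYT}_n$ is the finite set of reduced tableaux. For cells $(i,j),(i,j+1)$ both in $T$, $\mathrm{Leg}^+_T(i,j)=C_j\cap\{T_{ij},\dots,T_{i,j+1}\}$ if $T_{i,j+1}\notin C_j$, else $\varnothing$ ($\varnothing$ if a cell is missing). $\Phi_T(Y)=\prod_{\mathrm{Leg}^+_T(i,j)\neq\varnothing}(1-Y^{\#\mathrm{Leg}^+_T(i,j)})$. For variables $\mathbf X=(X_C)_{\varnothing\ne C\subseteq[n]}$, $\mathsf{HLS}_n(Y,\mathbf X)=\sum_{T\in\mathrm{rSSYT}_n}\Phi_T(Y)\prod_{C\in T}\frac{X_C}{1-X_C}$; $\mathsf{HLS}_n(Y,(f_C)_C)$ denotes the substitution $X_C\mapsto f_C$. Variables $\mathbf x=(x_1,\dots,x_n)$, $X$; $\mathbf x_C=\prod_{i\in C}x_i$ ($\mathbf x_\varnothing=1$). For a partition $\lambda$ with at most $n$ parts, $P_\lambda(\mathbf x;t)$ is the Hall–Littlewood polynomial $P_\lambda(\mathbf x;t)=\frac{1}{v_\lambda(t)}\sum_{w\in S_n}w\bigl(x_1^{\lambda_1}\cdots x_n^{\lambda_n}\prod_{i<j}\frac{x_i-tx_j}{x_i-x_j}\bigr)$,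 where $v_\lambda(t)=\prod_{m\ge0}\prod_{i=1}^{m_i'}\frac{1-t^i}{1-t}$ with $m_i'$ ranging over multiplicities: precisely $v_\lambda(t)=\prod_{m\ge0}\prod_{i=1}^{\#\{k:\lambda_k=m\}}\frac{1-t^i}{1-t}$ (parts $\lambda_k$, $k\in[n]$, zeros included). Define $\mathsf H_n(Y;\mathbf x,X)=\frac{1}{1-X}\sum_{\lambda}P_\lambda(\mathbf x;Y)X^{\lambda_1}$, the sum over all partitions with at most $n$ parts. *)

theory Defs
  imports "HOL-Library.Poly_Mapping"
          "HOL-Computational_Algebra.Fraction_Field"
          "HOL-Computational_Algebra.Formal_Power_Series"
          "HOL-Combinatorics.Permutations"
begin

type_synonym mpoly_int = "(nat \<Rightarrow>\<^sub>0 nat) \<Rightarrow>\<^sub>0 int"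
type_synonym ratfun = "mpoly_int fract"

(* the k-th polynomial variable; variable 0 is Y, variable i (i >= 1) is x_i *)
definition mvar :: "nat \<Rightarrow> mpoly_int" where
  "mvar k = Poly_Mapping.single (Poly_Mapping.single k 1) 1"

definition Yv :: ratfun where "Yv = Fraction_Field.Fract (mvar 0) 1"
definition xv :: "nat \<Rightarrow> ratfun" where "xv i = Fraction_Field.Fract (mvar i) 1"

definition xC :: "nat set \<Rightarrow> ratfun" where "xC C = (\<Prod>i\<in>C. xv i)"

section \<open>Semistandard Young tableaux as lists of columns\<close>

(* T_{ij}: entry in row i, column j (0-based), i.e. the i-th smallest element of column j *)
definition entry :: "nat set list \<Rightarrow> nat \<Rightarrow> nat \<Rightarrow> nat" where
  "entry T i j = sorted_list_of_set (T ! j) ! i"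

definition in_cell :: "nat set list \<Rightarrow> nat \<Rightarrow> nat \<Rightarrow> bool" where
  "in_cell T i j \<longleftrightarrow> j < length T \<and> i < card (T ! j)"

definition SSYT :: "nat \<Rightarrow> nat set list \<Rightarrow> bool" where
  "SSYT n T \<longleftrightarrow>
     (\<forall>C\<in>set T. C \<noteq> {} \<and> C \<subseteq> {1..n}) \<and>
     (\<forall>j. j + 1 < length T \<longrightarrow>
        card (T ! (j+1)) \<le> card (T ! j) \<and>
        (\<forall>i < card (T ! (j+1)). entry T i j \<le> entry T i (j+1)))"

definition rSSYT :: "nat \<Rightarrow> nat set list set" where
  "rSSYT n = {T. SSYT n T \<and> distinct T}"

definition LegP :: "nat set list \<Rightarrow> nat \<Rightarrow> nat \<Rightarrow> nat set" where
  "LegP T i j =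
     (if in_cell T i j \<and> in_cell T i (j+1) \<and> entry T i (j+1) \<notin> T ! j
      then T ! j \<inter> {entry T i j .. entry T i (j+1)} else {})"

definition Phi :: "nat set list \<Rightarrow> 'a::comm_ring_1 \<Rightarrow> 'a" where
  "Phi T Y = (\<Prod>(i,j)\<in>{(i,j). in_cell T i j \<and> LegP T i j \<noteq> {}}.
                 (1 - Y ^ card (LegP T i j)))"

(* HLS_n(Y, X) with X = (X_C)_C evaluated in a ring where X_C/(1-X_C) makes sense *)
definition HLS :: "nat \<Rightarrow> 'a::{comm_ring_1,inverse} \<Rightarrow> (nat set \<Rightarrow> 'a) \<Rightarrow> 'a" where
  "HLS n Y X = (\<Sum>T\<in>rSSYT n. Phi T Y * (\<Prod>C\<in>set T. X C * inverse (1 - X C)))"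

(* partitions with at most n parts: weakly decreasing lists of length n (zeros included) *)
definition partitions_le :: "nat \<Rightarrow> nat list set" where
  "partitions_le n = {lam. length lam = n \<and> sorted_wrt (\<ge>) lam}"

definition part1 :: "nat list \<Rightarrow> nat" where
  "part1 lam = (if lam = [] then 0 else hd lam)"

definition v_lam :: "nat list \<Rightarrow> 'a::field \<Rightarrow> 'a" where
  "v_lam lam t = (\<Prod>m\<in>set lam. \<Prod>i=1..count_list lam m. (1 - t ^ i) / (1 - t))"

definition HL_P :: "nat \<Rightarrow> (nat \<Rightarrow> 'a::field) \<Rightarrow> 'a \<Rightarrow> nat list \<Rightarrow> 'a" where
  "HL_P n x t lam = (1 / v_lam lam t) *
     (\<Sum>w\<in>{w. w permutes {1..n}}.
        (\<Prod>k\<in>{1..n}. x (w k) ^ (lam ! (k - 1))) *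
        (\<Prod>(i,j)\<in>{(i,j). 1 \<le> i \<and> i < j \<and> j \<le> n}.
            (x (w i) - t * x (w j)) / (x (w i) - x (w j))))"

definition H_series :: "nat \<Rightarrow> ratfun fps" where
  "H_series n = inverse (1 - fps_X) *
     Abs_fps (\<lambda>k. \<Sum>lam\<in>{lam\<in>partitions_le n. part1 lam = k}. HL_P n xv Yv lam)"

end

theory Submission
  imports Defs "HOL-Combinatorics.Multiset_Permutations"
begin

text \<open>
  Grouping the permutations \<open>w\<close> by the level sets \<open>S\<^sub>m = {w k | \<lambda>\<^sub>k \<ge> m}\<close> writes
  \<open>P\<^sub>\<lambda>(x;t)\<close> as a sum over flags \<open>{1..n} \<supseteq> S\<^sub>1 \<supseteq> S\<^sub>2 \<supseteq> \<dots>\<close>, the weight of a step from \<open>S\<close> to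
  \<open>R \<subseteq> S\<close> being the product of all \<open>x\<^sub>i\<close> for \<open>i \<in> R\<close> and all \<open>(x\<^sub>i - t x\<^sub>j)/(x\<^sub>i - x\<^sub>j)\<close> for
  \<open>i \<in> R\<close>, \<open>j \<in> S - R\<close>. Likewise \<open>\<Phi>\<^sub>T\<close> is a product over adjacent columns. So both sides are
  transfer matrix products on subsets of \<open>{1..n}\<close>, and the two matrices are connected by
  \<open>n\<close> intertwining operators, which replace one entry at a time by its tableau behaviour (a
  branching rule). Coefficientwise, the intertwining relation is a partial fraction expansion of
  \<open>\<Prod>\<^sub>q (z - t x\<^sub>q)/(z - x\<^sub>q)\<close>. Repeated columns contribute the geometric series
  \<open>X\<^sub>C/(1 - X\<^sub>C)\<close>, and dropping the factor \<open>1/(1 - X)\<close> amounts to forbidding empty columns.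
\<close>

subsection \<open>Partial fractions\<close>

text \<open>The hypotheses keep all denominators nonzero: \<open>x i - x j\<close> for distinct
  indices, \<open>t\<close> itself, \<open>1 - t\<close> and the factors of \<open>v_lam\<close> (by
  \<open>t_power_neq_1\<close>), and the products of \<open>x i - t * x j\<close>, by which
  \<open>prod_out_minus_power\<close> divides.\<close>

locale hall_littlewood =
  fixes x :: "nat \<Rightarrow> 'a::field" and t :: 'a
  assumes inj_x: "inj x"
    and x_neq_tx: "x i \<noteq> t * x j"
    and t_neq_0: "t \<noteq> 0"
    and t_power_neq_1: "0 < i \<Longrightarrow> t ^ i \<noteq> 1"
begin

definition a :: "'a \<Rightarrow> 'a \<Rightarrow> 'a" where "a u v = (u - t * v) / (u - v)"

definition A :: "nat set \<Rightarrow> nat set \<Rightarrow> 'a" where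
  "A I J = (\<Prod>i\<in>I. \<Prod>j\<in>J. a (x i) (x j))"

lemma t_neq_1: "t \<noteq> 1"
  using t_power_neq_1[of 1] by simp

lemma x_eq_iff [simp]: "x i = x j \<longleftrightarrow> i = j"
  using inj_x by (auto dest: injD)

text \<open>As a function of \<open>z\<close> the product has simple poles at the \<open>x j\<close>
  and tends to 1 at infinity; the sum carries its residues. The induction uses the expansion for
  \<open>Q\<close> both at \<open>z\<close> and at \<open>x q\<close>.\<close>

lemma prod_out:
  assumes "finite Q" "z \<notin> x ` Q"
  shows "(\<Prod>q\<in>Q. a z (x q)) =
    1 + (\<Sum>j\<in>Q. (1 - t) * x j / (z - x j) * (\<Prod>q\<in>Q - {j}. a (x j) (x q)))"
  using assms
proof (induction Q arbitrary: z rule: finite_induct)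
  case (insert q Q)
  let ?c = "\<lambda>z j. (1 - t) * x j / (z - x j)"
  let ?B = "\<lambda>j. \<Prod>q\<in>Q - {j}. a (x j) (x q)"
  have zq: "z \<noteq> x q" and zj: "\<And>j. j \<in> Q \<Longrightarrow> z \<noteq> x j" using insert.prems by auto
  have jq: "x j \<noteq> x q" if "j \<in> Q" for j using that insert.hyps by auto
  \<comment> \<open>A product of two simple poles, at \<open>x q\<close> and at \<open>x j\<close>,
    splits into one pole at each.\<close>
  have split: "a z (x q) * (?c z j * B) = ?c z j * (a (x j) (x q) * B) + ?c z q * (?c (x q) j * B)"
    if "j \<in> Q" for j B
  proof -
    have "a z (x q) * ?c z j = ?c z j * a (x j) (x q) + ?c z q * ?c (x q) j"
      using zq zj[OF that] jq[OF that] unfolding a_def by (simp add: divide_simps) (simp add: algebra_simps)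
    then show ?thesis by algebra
  qed
  have ins: "(\<Prod>q'\<in>insert q Q - {j}. a (x j) (x q')) = a (x j) (x q) * ?B j" if "j \<in> Q" for j
  proof -
    have "insert q Q - {j} = insert q (Q - {j})" using that insert.hyps by auto
    then show ?thesis using insert.hyps by simp
  qed
  have q: "a z (x q) = 1 + ?c z q"
    using zq unfolding a_def by (simp add: divide_simps) (simp add: algebra_simps)
  have IHq: "(\<Prod>q'\<in>Q. a (x q) (x q')) = 1 + (\<Sum>j\<in>Q. ?c (x q) j * ?B j)"
    by (rule insert.IH) (use insert.hyps in auto)
  have "(\<Prod>q\<in>insert q Q. a z (x q)) = a z (x q) * (1 + (\<Sum>j\<in>Q. ?c z j * ?B j))"
    using insert by simp
  also have "\<dots> = a z (x q) + (\<Sum>j\<in>Q. a z (x q) * (?c z j * ?B j))"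
    by (simp add: distrib_left sum_distrib_left)
  also have "(\<Sum>j\<in>Q. a z (x q) * (?c z j * ?B j)) =
    (\<Sum>j\<in>Q. ?c z j * (a (x j) (x q) * ?B j)) + ?c z q * (\<Sum>j\<in>Q. ?c (x q) j * ?B j)"
    unfolding sum_distrib_left sum.distrib[symmetric] by (intro sum.cong refl split)
  also have "a z (x q) + \<dots> = 1 + (?c z q * (1 + (\<Sum>j\<in>Q. ?c (x q) j * ?B j)) +
     (\<Sum>j\<in>Q. ?c z j * (a (x j) (x q) * ?B j)))"
    unfolding q by algebra
  also have "\<dots> = 1 + (\<Sum>j\<in>insert q Q. ?c z j * (\<Prod>q'\<in>insert q Q - {j}. a (x j) (x q')))"
    unfolding IHq[symmetric] using insert.hyps ins by (simp cong: sum.cong)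
  finally show ?case .
qed simp

text \<open>Partial fractions with \<open>z\<close> in the second slot. Every summand vanishes at
  \<open>z = 0\<close>, where the product is 1, so the expansion is normalised at 0 instead of at
  infinity.\<close>

lemma prod_in:
  assumes "finite Q" "z \<notin> x ` Q"
  shows "(\<Prod>q\<in>Q. a (x q) z) +
    (\<Sum>j\<in>Q. (1 - t) * z / (z - x j) * (\<Prod>q\<in>Q - {j}. a (x q) (x j))) = 1"
  using assms
proof (induction Q arbitrary: z rule: finite_induct)
  case (insert q Q)
  let ?c = "\<lambda>z j. (1 - t) * z / (z - x j)"
  let ?B = "\<lambda>j. \<Prod>q\<in>Q - {j}. a (x q) (x j)"
  have zq: "z \<noteq> x q" and zj: "\<And>j. j \<in> Q \<Longrightarrow> z \<noteq> x j" using insert.prems by auto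
  have jq: "x j \<noteq> x q" if "j \<in> Q" for j using that insert.hyps by auto
  have split: "a (x q) z * (?c z j * B) = ?c z j * (a (x q) (x j) * B) - ?c z q * (?c (x q) j * B)"
    if "j \<in> Q" for j B
  proof -
    have "a (x q) z * ?c z j = ?c z j * a (x q) (x j) - ?c z q * ?c (x q) j"
      using zq zj[OF that] jq[OF that] unfolding a_def by (simp add: divide_simps) (simp add: algebra_simps)
    then show ?thesis by algebra
  qed
  have ins: "(\<Prod>q'\<in>insert q Q - {j}. a (x q') (x j)) = a (x q) (x j) * ?B j" if "j \<in> Q" for j
  proof -
    have "insert q Q - {j} = insert q (Q - {j})" using that insert.hyps by auto
    then show ?thesis using insert.hyps by simp
  qed
  have q: "a (x q) z = 1 - ?c z q"
    using zq unfolding a_def by (simp add: divide_simps) (simp add: algebra_simps)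
  have IHq: "(\<Prod>q'\<in>Q. a (x q') (x q)) = 1 - (\<Sum>j\<in>Q. ?c (x q) j * ?B j)"
    unfolding eq_diff_eq by (rule insert.IH) (use insert.hyps in auto)
  have IHz: "(\<Prod>q'\<in>Q. a (x q') z) = 1 - (\<Sum>j\<in>Q. ?c z j * ?B j)"
    unfolding eq_diff_eq by (rule insert.IH) (use insert.prems in auto)
  have "(\<Prod>q\<in>insert q Q. a (x q) z) = a (x q) z * (1 - (\<Sum>j\<in>Q. ?c z j * ?B j))"
    using insert.hyps IHz by simp
  also have "\<dots> = a (x q) z - (\<Sum>j\<in>Q. a (x q) z * (?c z j * ?B j))"
    by (simp add: right_diff_distrib sum_distrib_left)
  also have "(\<Sum>j\<in>Q. a (x q) z * (?c z j * ?B j)) =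
    (\<Sum>j\<in>Q. ?c z j * (a (x q) (x j) * ?B j)) - ?c z q * (\<Sum>j\<in>Q. ?c (x q) j * ?B j)"
    unfolding sum_distrib_left sum_subtractf[symmetric] by (intro sum.cong refl split)
  also have "a (x q) z - \<dots> = 1 - (?c z q * (1 - (\<Sum>j\<in>Q. ?c (x q) j * ?B j)) +
     (\<Sum>j\<in>Q. ?c z j * (a (x q) (x j) * ?B j)))"
    unfolding q by algebra
  also have "\<dots> = 1 - (\<Sum>j\<in>insert q Q. ?c z j * (\<Prod>q'\<in>insert q Q - {j}. a (x q') (x j)))"
    unfolding IHq[symmetric] using insert.hyps ins by (simp cong: sum.cong)
  finally show ?case by simp
qed simp

text \<open>Adjoining \<open>q\<close> multiplies the term of \<open>j\<close> by
  \<open>a (x j) (x q)\<close>, which is \<open>t\<close> minus a correction. Expanding the new term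
  by \<open>prod_out\<close> at \<open>z = x q\<close> cancels all corrections and leaves the
  recursion of the t-integers.\<close>

lemma sum_prod_out:
  assumes "finite Q"
  shows "(\<Sum>j\<in>Q. \<Prod>q\<in>Q - {j}. a (x j) (x q)) = (1 - t ^ card Q) / (1 - t)"
  using assms
proof (induction Q rule: finite_induct)
  case (insert q Q)
  let ?B = "\<lambda>j. \<Prod>q\<in>Q - {j}. a (x j) (x q)"
  have ins: "(\<Prod>q'\<in>insert q Q - {j}. a (x j) (x q')) =
      t * ?B j - (1 - t) * x j / (x q - x j) * ?B j" if "j \<in> Q" for j
  proof -
    have "insert q Q - {j} = insert q (Q - {j})" using that insert.hyps by auto
    then have "(\<Prod>q'\<in>insert q Q - {j}. a (x j) (x q')) = a (x j) (x q) * ?B j"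
      using insert.hyps by simp
    moreover have "x j \<noteq> x q" using that insert.hyps by auto
    then have "a (x j) (x q) = t - (1 - t) * x j / (x q - x j)"
      unfolding a_def by (simp add: divide_simps) (simp add: algebra_simps)
    ultimately show ?thesis by (simp add: algebra_simps)
  qed
  have "(\<Sum>j\<in>insert q Q. \<Prod>q'\<in>insert q Q - {j}. a (x j) (x q')) =
    (\<Prod>q'\<in>Q. a (x q) (x q')) +
    (t * (\<Sum>j\<in>Q. ?B j) - (\<Sum>j\<in>Q. (1 - t) * x j / (x q - x j) * ?B j))"
    unfolding sum_distrib_left sum_subtractf[symmetric]
    using insert.hyps ins by (simp cong: sum.cong)
  also have "(\<Prod>q'\<in>Q. a (x q) (x q')) = 1 + (\<Sum>j\<in>Q. (1 - t) * x j / (x q - x j) * ?B j)"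
    by (rule prod_out) (use insert.hyps in auto)
  finally have "(\<Sum>j\<in>insert q Q. \<Prod>q'\<in>insert q Q - {j}. a (x j) (x q')) =
     1 + t * ((1 - t ^ card Q) / (1 - t))" by (simp add: insert.IH)
  also have "\<dots> = (1 - t ^ Suc (card Q)) / (1 - t)"
    using t_neq_1 by (simp add: divide_simps) (simp add: algebra_simps)
  finally show ?case using insert.hyps by simp
qed simp

text \<open>This is \<open>prod_in\<close> at \<open>x p / t\<close>, multiplied by \<open>A {p} Q\<close>.\<close>

lemma prod_out_minus_power:
  assumes "finite Q" "p \<notin> Q"
  shows "A {p} Q - t ^ card Q =
    (\<Sum>j\<in>Q. (1 - t) * x p / (x p - x j) * (A (Q - {j}) {j} * A {p} (Q - {j})))"
proof -
  have ne: "x p \<noteq> x q" if "q \<in> Q" for q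
    using that \<open>p \<notin> Q\<close> by auto
  have nz: "a (x p) (x q) \<noteq> 0" if "q \<in> Q" for q
    using x_neq_tx[of p q] ne[OF that] by (simp add: a_def)
  have "x p / t \<noteq> x q" for q
    using x_neq_tx[of p q] t_neq_0 by (simp add: field_simps)
  then have "(\<Prod>q\<in>Q. a (x q) (x p / t)) + (\<Sum>j\<in>Q. (1 - t) * (x p / t) / (x p / t - x j) *
      (\<Prod>q\<in>Q - {j}. a (x q) (x j))) = 1"
    by (intro prod_in assms) auto
  \<comment> \<open>The substitution turns each factor into \<open>t\<close> over the opposite
    factor, so the whole product becomes a power of \<open>t\<close> over
    \<open>A {p} Q\<close>.\<close>
  also have "(\<Prod>q\<in>Q. a (x q) (x p / t)) = (\<Prod>q\<in>Q. t / a (x p) (x q))"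
  proof (rule prod.cong)
    fix q assume q: "q \<in> Q"
    have "t * x q - x p \<noteq> 0" "x p - t * x q \<noteq> 0" using x_neq_tx[of p q] by auto
    then show "a (x q) (x p / t) = t / a (x p) (x q)"
      using t_neq_0 ne[OF q] unfolding a_def by (simp add: field_simps)
  qed simp
  also have "\<dots> = t ^ card Q / A {p} Q"
    by (simp add: prod_dividef A_def)
  also have "(\<Sum>j\<in>Q. (1 - t) * (x p / t) / (x p / t - x j) * (\<Prod>q\<in>Q - {j}. a (x q) (x j))) =
    (\<Sum>j\<in>Q. (1 - t) * x p / (x p - x j) * (A (Q - {j}) {j} * A {p} (Q - {j}))) / A {p} Q"
    unfolding sum_divide_distrib
  proof (rule sum.cong)
    fix j assume j: "j \<in> Q"
    have 1: "A {p} Q = a (x p) (x j) * A {p} (Q - {j})"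
      using prod.remove[OF assms(1) j] by (simp add: A_def)
    have 2: "A {p} (Q - {j}) \<noteq> 0"
      using nz assms(1) by (simp add: A_def)
    have 3: "(1 - t) * (x p / t) / (x p / t - x j) = (1 - t) * x p / (x p - x j) / a (x p) (x j)"
      using t_neq_0 x_neq_tx[of p j] ne[OF j] unfolding a_def
      by (simp add: divide_simps mult.commute[of _ t])
    have "(\<Prod>q\<in>Q - {j}. a (x q) (x j)) = A (Q - {j}) {j}"
      by (simp add: A_def)
    then show "(1 - t) * (x p / t) / (x p / t - x j) * (\<Prod>q\<in>Q - {j}. a (x q) (x j)) =
        (1 - t) * x p / (x p - x j) * (A (Q - {j}) {j} * A {p} (Q - {j})) / A {p} Q"
      unfolding 1 3 using 2 by simp
  qed simp
  finally have "(t ^ card Q + (\<Sum>j\<in>Q. (1 - t) * x p / (x p - x j) *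
      (A (Q - {j}) {j} * A {p} (Q - {j})))) / A {p} Q = 1"
    by (simp add: add_divide_distrib)
  moreover have "A {p} Q \<noteq> 0"
    using nz assms(1) by (simp add: A_def)
  ultimately show ?thesis by (simp add: field_simps)
qed
end

subsection \<open>The branching rule for one step\<close>

lemma sum_Pow_swap_insert:
  fixes f :: "'b set \<Rightarrow> 'b \<Rightarrow> 'c::comm_monoid_add"
  assumes "finite S"
  shows "(\<Sum>R\<in>Pow S. \<Sum>j\<in>R. f R j) = (\<Sum>R\<in>Pow S. \<Sum>j\<in>S - R. f (insert j R) j)"
proof -
  have fin: "finite R" if "R \<in> Pow S" for R using that assms by (auto intro: finite_subset)
  have "(\<Sum>R\<in>Pow S. \<Sum>j\<in>R. f R j) = (\<Sum>(R, j)\<in>(SIGMA R:Pow S. R). f R j)"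
    using assms fin by (intro sum.Sigma) auto
  also have "\<dots> = (\<Sum>(R, j)\<in>(SIGMA R:Pow S. S - R). f (insert j R) j)"
    by (rule sum.reindex_bij_witness[where i = "\<lambda>(R, j). (insert j R, j)" and j = "\<lambda>(R, j). (R - {j}, j)"])
       (auto simp: insert_absorb)
  also have "\<dots> = (\<Sum>R\<in>Pow S. \<Sum>j\<in>S - R. f (insert j R) j)"
    using assms by (intro sum.Sigma[symmetric]) auto
  finally show ?thesis .
qed

lemma sum_Pow_remove_swap:
  fixes f :: "'b \<Rightarrow> 'b set \<Rightarrow> 'c::comm_monoid_add"
  assumes "finite S"
  shows "(\<Sum>j\<in>S. \<Sum>R\<in>Pow (S - {j}). f j R) = (\<Sum>R\<in>Pow S. \<Sum>j\<in>S - R. f j R)"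
proof -
  have "(\<Sum>j\<in>S. \<Sum>R\<in>Pow (S - {j}). f j R) = (\<Sum>(j, R)\<in>(SIGMA j:S. Pow (S - {j})). f j R)"
    using assms by (intro sum.Sigma) auto
  also have "\<dots> = (\<Sum>(R, j)\<in>(SIGMA R:Pow S. S - R). f j R)"
    by (rule sum.reindex_bij_witness[where i = "\<lambda>(R, j). (j, R)" and j = "\<lambda>(j, R). (R, j)"]) auto
  also have "\<dots> = (\<Sum>R\<in>Pow S. \<Sum>j\<in>S - R. f j R)"
    using assms by (intro sum.Sigma[symmetric]) auto
  finally show ?thesis .
qed

text \<open>This isolates \<open>Suc m\<close>, the one entry that two consecutive interpolating
  kernels treat differently.\<close>

lemma sum_Pow_interval_split:
  fixes h :: "nat set \<Rightarrow> 'c::comm_monoid_add"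
  assumes "m < n"
  shows "(\<Sum>C\<in>Pow {1..n}. h C) =
    (\<Sum>E\<in>Pow {Suc m<..n}. \<Sum>R\<in>Pow {1..m}. h (R \<union> E) + h (R \<union> insert (Suc m) E))"
proof -
  let ?p = "Suc m"
  have un: "C \<inter> {1..?p} \<union> C \<inter> {?p<..n} = C" if "C \<subseteq> {1..n}" for C
    using that assms by auto
  have "(\<Sum>C\<in>Pow {1..n}. h C) = (\<Sum>(E, B)\<in>Pow {?p<..n} \<times> Pow {1..?p}. h (B \<union> E))"
    by (rule sum.reindex_bij_witness[where i = "\<lambda>(E, B). B \<union> E" and
          j = "\<lambda>C. (C \<inter> {?p<..n}, C \<inter> {1..?p})"]) (use assms in \<open>auto simp: un[simplified]\<close>)
  also have "\<dots> = (\<Sum>E\<in>Pow {?p<..n}. \<Sum>B\<in>Pow {1..?p}. h (B \<union> E))"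
    by (rule sum.cartesian_product[symmetric])
  also have "\<dots> = (\<Sum>E\<in>Pow {?p<..n}. \<Sum>R\<in>Pow {1..m}. h (R \<union> E) + h (R \<union> insert ?p E))"
  proof (rule sum.cong[OF refl])
    fix E
    have Pow: "Pow {1..?p} = Pow {1..m} \<union> insert ?p ` Pow {1..m}"
      by (simp add: atLeastAtMostSuc_conv Pow_insert)
    have inj: "inj_on (insert ?p) (Pow {1..m})"
      by (rule inj_onI, subst (asm) insert_ident) auto
    have "(\<Sum>B\<in>Pow {1..?p}. h (B \<union> E)) =
      (\<Sum>R\<in>Pow {1..m}. h (R \<union> E)) + (\<Sum>B\<in>insert ?p ` Pow {1..m}. h (B \<union> E))"
      unfolding Pow by (rule sum.union_disjoint) auto
    then show "(\<Sum>B\<in>Pow {1..?p}. h (B \<union> E)) =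
      (\<Sum>R\<in>Pow {1..m}. h (R \<union> E) + h (R \<union> insert ?p E))"
      unfolding sum.reindex[OF inj] by (simp add: sum.distrib)
  qed
  finally show ?thesis .
qed

context hall_littlewood
begin

lemma A_empty [simp]: "A {} J = 1" "A I {} = 1"
  by (simp_all add: A_def)

lemma A_insert_left: "finite I \<Longrightarrow> i \<notin> I \<Longrightarrow> A (insert i I) J = A {i} J * A I J"
  by (simp add: A_def)

lemma A_insert_right: "finite J \<Longrightarrow> j \<notin> J \<Longrightarrow> A I (insert j J) = A I {j} * A I J"
  by (simp add: A_def prod.distrib)

lemma A_remove_right: "finite J \<Longrightarrow> j \<in> J \<Longrightarrow> A I J = A I {j} * A I (J - {j})"
  using A_insert_right[of "J - {j}" j I] by (simp add: insert_absorb)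

lemma A_union_left: "finite I \<Longrightarrow> finite I' \<Longrightarrow> I \<inter> I' = {} \<Longrightarrow> A (I \<union> I') J = A I J * A I' J"
  by (simp add: A_def prod.union_disjoint)

definition X :: "nat set \<Rightarrow> 'a" where "X C = (\<Prod>i\<in>C. x i)"

definition raise_coeff :: "nat \<Rightarrow> nat \<Rightarrow> 'a" where "raise_coeff p j = (1 - t) * x p / (x p - x j)"

text \<open>This is \<open>prod_out\<close> at \<open>z = x p\<close>, rescaled by
  \<open>x p\<close> so that \<open>raise_coeff\<close> appears.\<close>

lemma A_out:
  assumes "finite Q" "p \<notin> Q"
  shows "(\<Sum>j\<in>Q. x j * raise_coeff p j * A {j} (Q - {j})) = x p * (A {p} Q - 1)"
proof -
  have "A {p} Q = 1 + (\<Sum>j\<in>Q. (1 - t) * x j / (x p - x j) * A {j} (Q - {j}))"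
    using prod_out[of Q "x p"] assms by (simp add: A_def inj_image_mem_iff[OF inj_x])
  then have "x p * (A {p} Q - 1) = (\<Sum>j\<in>Q. x p * ((1 - t) * x j / (x p - x j) * A {j} (Q - {j})))"
    by (simp add: sum_distrib_left)
  also have "\<dots> = (\<Sum>j\<in>Q. x j * raise_coeff p j * A {j} (Q - {j}))"
    by (intro sum.cong) (simp_all add: raise_coeff_def)
  finally show ?thesis by simp
qed

lemma A_in:
  assumes "finite Q" "p \<notin> Q"
  shows "A Q {p} + (\<Sum>j\<in>Q. raise_coeff p j * A (Q - {j}) {j}) = 1"
  using prod_in[of Q "x p"] assms by (simp add: A_def raise_coeff_def inj_image_mem_iff[OF inj_x])

text \<open>For \<open>G S\<close> the Hall-Littlewood polynomial in the variables indexed by \<open>S\<close>,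
  \<open>raise p G S\<close> is the sum over all tableaux with entries in \<open>insert p S\<close> of the given shape
  whose columns all follow a column with entries \<open>S\<close>.\<close>

definition raise :: "nat \<Rightarrow> (nat set \<Rightarrow> 'a) \<Rightarrow> nat set \<Rightarrow> 'a" where
  "raise p G S = A S {p} * G S + (\<Sum>j\<in>S. raise_coeff p j * A (S - {j}) {j} * G (insert p (S - {j})))"

lemma raise_const_one: "finite S \<Longrightarrow> p \<notin> S \<Longrightarrow> raise p (\<lambda>_. 1) S = 1"
  using A_in by (simp add: raise_def)

lemma raise_sum: "raise p (\<lambda>B. \<Sum>e\<in>D. d e * G e B) S = (\<Sum>e\<in>D. d e * raise p (G e) S)"
proof -
  have "(\<Sum>j\<in>S. raise_coeff p j * A (S - {j}) {j} * (\<Sum>e\<in>D. d e * G e (insert p (S - {j})))) =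
    (\<Sum>e\<in>D. d e * (\<Sum>j\<in>S. raise_coeff p j * A (S - {j}) {j} * G e (insert p (S - {j}))))"
    unfolding sum_distrib_left by (subst sum.swap) (simp add: mult_ac)
  then show ?thesis
    by (simp add: raise_def distrib_left sum.distrib sum_distrib_left mult.left_commute)
qed

text \<open>\<open>raise\<close> evaluates its argument only at \<open>S\<close> and at sets where
  \<open>p\<close> replaces one element of \<open>S\<close>, all of the same size. This serves for
  \<open>jump\<close>, which sees the smaller entries only through their number.\<close>

lemma raise_card:
  assumes "finite S" "p \<notin> S"
  shows "raise p (\<lambda>B. q (card B) * G B) S = q (card S) * raise p G S"
proof -
  have "card (insert p (S - {j})) = card S" if "j \<in> S" for j
    using assms that card_Suc_Diff1[OF assms(1) that] by simp
  then have "(\<Sum>j\<in>S. raise_coeff p j * A (S - {j}) {j} * (q (card (insert p (S - {j}))) * G (insert p (S - {j})))) =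
    q (card S) * (\<Sum>j\<in>S. raise_coeff p j * A (S - {j}) {j} * G (insert p (S - {j})))"
    unfolding sum_distrib_left by (intro sum.cong) simp_all
  then show ?thesis by (simp add: raise_def distrib_left)
qed

text \<open>In the terms where \<open>p\<close> replaces \<open>j\<close> in \<open>R\<close>, the
  set \<open>R - {j}\<close> becomes the new summation index. Then \<open>j\<close> ranges over the
  complement of that set, and \<open>A_out\<close> evaluates the sum over \<open>j\<close>.\<close>

lemma sum_raise:
  assumes "finite S" "p \<notin> S"
  shows "(\<Sum>R\<in>Pow S. A R (S - R) * X R * raise p G R) =
    (\<Sum>R\<in>Pow S. A R (S - R) * X R *
      (A R {p} * G R + x p * (A {p} (S - R) - 1) * G (insert p R)))"
proof -
  have "(\<Sum>R\<in>Pow S. A R (S - R) * X R * raise p G R) =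
    (\<Sum>R\<in>Pow S. A R (S - R) * X R * (A R {p} * G R)) +
    (\<Sum>R\<in>Pow S. \<Sum>j\<in>R. A R (S - R) * X R * (raise_coeff p j * A (R - {j}) {j} * G (insert p (R - {j}))))"
    by (simp add: raise_def distrib_left sum.distrib sum_distrib_left)
  also have "(\<Sum>R\<in>Pow S. \<Sum>j\<in>R. A R (S - R) * X R * (raise_coeff p j * A (R - {j}) {j} * G (insert p (R - {j})))) =
    (\<Sum>R\<in>Pow S. \<Sum>j\<in>S - R. A (insert j R) (S - insert j R) * X (insert j R) *
       (raise_coeff p j * A (insert j R - {j}) {j} * G (insert p (insert j R - {j}))))"
    by (rule sum_Pow_swap_insert[OF assms(1)])
  also have "\<dots> = (\<Sum>R\<in>Pow S. A R (S - R) * X R * (x p * (A {p} (S - R) - 1) * G (insert p R)))"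
  proof (rule sum.cong[OF refl])
    fix R assume "R \<in> Pow S"
    then have R: "finite R" "R \<subseteq> S" using assms by (auto intro: finite_subset)
    have "A (insert j R) (S - insert j R) * X (insert j R) *
       (raise_coeff p j * A (insert j R - {j}) {j} * G (insert p (insert j R - {j}))) =
       A R (S - R) * X R * G (insert p R) * (x j * raise_coeff p j * A {j} (S - R - {j}))"
      if "j \<in> S - R" for j
    proof -
      have "S - insert j R = S - R - {j}" "insert j R - {j} = R" using that by auto
      moreover have "A (insert j R) (S - R - {j}) = A {j} (S - R - {j}) * A R (S - R - {j})"
        using R that by (intro A_insert_left) auto
      moreover have "A R (S - R) = A R {j} * A R (S - R - {j})"
        using assms that by (intro A_remove_right) auto
      moreover have "X (insert j R) = x j * X R"
        using R that by (simp add: X_def)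
      ultimately show ?thesis by (simp add: mult_ac)
    qed
    then have "(\<Sum>j\<in>S - R. A (insert j R) (S - insert j R) * X (insert j R) *
       (raise_coeff p j * A (insert j R - {j}) {j} * G (insert p (insert j R - {j})))) =
       (\<Sum>j\<in>S - R. A R (S - R) * X R * G (insert p R) * (x j * raise_coeff p j * A {j} (S - R - {j})))"
      by (rule sum.cong[OF refl])
    also have "\<dots> = A R (S - R) * X R * G (insert p R) * (x p * (A {p} (S - R) - 1))"
      unfolding sum_distrib_left[symmetric] using assms by (subst A_out) auto
    finally show "(\<Sum>j\<in>S - R. A (insert j R) (S - insert j R) * X (insert j R) *
       (raise_coeff p j * A (insert j R - {j}) {j} * G (insert p (insert j R - {j})))) =
       A R (S - R) * X R * (x p * (A {p} (S - R) - 1) * G (insert p R))"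
      by (simp add: mult_ac)
  qed
  finally show ?thesis by (simp add: distrib_left sum.distrib)
qed

text \<open>The branching step when the previous column contains \<open>p\<close>. The
  \<open>- 1\<close> in \<open>sum_raise\<close> cancels the added term
  \<open>x p * G (insert p R)\<close>, and the remaining factors with \<open>p\<close> complete the
  weights of a flag step from \<open>insert p S\<close>.\<close>

lemma branch_in:
  assumes "finite S" "p \<notin> S"
  shows "(\<Sum>R\<in>Pow S. A R (S - R) * X R * (raise p G R + x p * G (insert p R))) =
    (\<Sum>R\<in>Pow S. X R * (A R (insert p S - R) * G R + A (insert p R) (S - R) * (x p * G (insert p R))))"
proof -
  have "(\<Sum>R\<in>Pow S. A R (S - R) * X R * (raise p G R + x p * G (insert p R))) =
    (\<Sum>R\<in>Pow S. A R (S - R) * X R *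
      (A R {p} * G R + x p * (A {p} (S - R) - 1) * G (insert p R))) +
    (\<Sum>R\<in>Pow S. A R (S - R) * X R * (x p * G (insert p R)))"
    by (simp add: distrib_left sum.distrib sum_raise[OF assms])
  also have "\<dots> = (\<Sum>R\<in>Pow S. A R (S - R) * X R *
      (A R {p} * G R + x p * A {p} (S - R) * G (insert p R)))"
    unfolding sum.distrib[symmetric] by (intro sum.cong refl) (simp add: algebra_simps)
  also have "\<dots> = (\<Sum>R\<in>Pow S. X R * (A R (insert p S - R) * G R +
      A (insert p R) (S - R) * (x p * G (insert p R))))"
  proof (rule sum.cong[OF refl])
    fix R assume "R \<in> Pow S"
    then have R: "finite R" "R \<subseteq> S" "p \<notin> R" using assms by (auto intro: finite_subset)
    have "insert p S - R = insert p (S - R)" using R by auto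
    moreover have "A R (insert p (S - R)) = A R {p} * A R (S - R)"
      using assms by (intro A_insert_right) auto
    moreover have "A (insert p R) (S - R) = A {p} (S - R) * A R (S - R)"
      using R by (intro A_insert_left) auto
    ultimately show "A R (S - R) * X R * (A R {p} * G R + x p * A {p} (S - R) * G (insert p R)) =
      X R * (A R (insert p S - R) * G R + A (insert p R) (S - R) * (x p * G (insert p R)))"
      by (simp add: algebra_simps)
  qed
  finally show ?thesis .
qed

text \<open>The branching step when the previous column lacks \<open>p\<close>:
  \<open>1 - t ^ (card S - card R)\<close> is the tableau weight of the new entry \<open>p\<close>,
  and the right-hand side is \<open>raise p\<close> of a flag step. Collected by \<open>R\<close>,
  the sums over \<open>j\<close> are evaluated by \<open>A_in\<close> for \<open>G R\<close> and by
  \<open>prod_out_minus_power\<close> for \<open>G (insert p R)\<close>.\<close>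

lemma branch_out:
  assumes "finite S" "p \<notin> S"
  shows "(\<Sum>R\<in>Pow S. A R (S - R) * X R *
      (raise p G R + (1 - t ^ (card S - card R)) * (x p * G (insert p R)))) =
    A S {p} * (\<Sum>R\<in>Pow S. X R * (A R (S - R) * G R)) +
    (\<Sum>j\<in>S. raise_coeff p j * A (S - {j}) {j} * (\<Sum>R\<in>Pow (S - {j}). X R *
      (A R (insert p (S - {j}) - R) * G R + A (insert p R) (S - {j} - R) * (x p * G (insert p R)))))"
    (is "?lhs = A S {p} * ?u + ?v")
proof -
  have "?v = (\<Sum>R\<in>Pow S. \<Sum>j\<in>S - R. raise_coeff p j * A (S - {j}) {j} * (X R *
      (A R (insert p (S - {j}) - R) * G R + A (insert p R) (S - {j} - R) * (x p * G (insert p R)))))"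
    unfolding sum_distrib_left by (rule sum_Pow_remove_swap[OF assms(1)])
  also have "\<dots> = (\<Sum>R\<in>Pow S. X R * A R (S - R) * (A R {p} * G R * (1 - A (S - R) {p}) +
      x p * G (insert p R) * (A {p} (S - R) - t ^ (card S - card R))))"
  proof (rule sum.cong[OF refl])
    fix R assume "R \<in> Pow S"
    then have R: "finite R" "R \<subseteq> S" "p \<notin> R" using assms by (auto intro: finite_subset)
    define Q where "Q = S - R"
    have Q: "finite Q" "p \<notin> Q" "card Q = card S - card R"
      using assms R by (auto simp: Q_def card_Diff_subset)
    have "raise_coeff p j * A (S - {j}) {j} * (X R *
      (A R (insert p (S - {j}) - R) * G R + A (insert p R) (S - {j} - R) * (x p * G (insert p R)))) =
      X R * A R Q * (A R {p} * G R) * (raise_coeff p j * A (Q - {j}) {j}) +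
      X R * A R Q * (x p * G (insert p R)) * (raise_coeff p j * (A (Q - {j}) {j} * A {p} (Q - {j})))"
      if "j \<in> Q" for j
    proof -
      have sets: "S - {j} = R \<union> (Q - {j})" "insert p (S - {j}) - R = insert p (Q - {j})"
        "S - {j} - R = Q - {j}"
        using that R by (auto simp: Q_def)
      have "A (R \<union> (Q - {j})) {j} = A R {j} * A (Q - {j}) {j}"
        using R Q by (intro A_union_left) (auto simp: Q_def)
      moreover have "A R (insert p (Q - {j})) = A R {p} * A R (Q - {j})"
        using Q by (intro A_insert_right) auto
      moreover have "A (insert p R) (Q - {j}) = A {p} (Q - {j}) * A R (Q - {j})"
        using R by (intro A_insert_left) auto
      moreover have "A R Q = A R {j} * A R (Q - {j})"
        using Q that by (intro A_remove_right) auto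
      ultimately show ?thesis unfolding sets(2,3) unfolding sets(1) by (simp add: algebra_simps)
    qed
    then have "(\<Sum>j\<in>Q. raise_coeff p j * A (S - {j}) {j} * (X R *
      (A R (insert p (S - {j}) - R) * G R + A (insert p R) (S - {j} - R) * (x p * G (insert p R))))) =
      (\<Sum>j\<in>Q. X R * A R Q * (A R {p} * G R) * (raise_coeff p j * A (Q - {j}) {j}) +
      X R * A R Q * (x p * G (insert p R)) * (raise_coeff p j * (A (Q - {j}) {j} * A {p} (Q - {j}))))"
      by (rule sum.cong[OF refl])
    also have "\<dots> = X R * A R Q * (A R {p} * G R) * (\<Sum>j\<in>Q. raise_coeff p j * A (Q - {j}) {j}) +
      X R * A R Q * (x p * G (insert p R)) * (\<Sum>j\<in>Q. raise_coeff p j * (A (Q - {j}) {j} * A {p} (Q - {j})))"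
      by (simp add: sum.distrib sum_distrib_left)
    also have "(\<Sum>j\<in>Q. raise_coeff p j * A (Q - {j}) {j}) = 1 - A Q {p}"
      using A_in[OF Q(1,2)] by (simp add: eq_diff_eq add.commute)
    also have "(\<Sum>j\<in>Q. raise_coeff p j * (A (Q - {j}) {j} * A {p} (Q - {j}))) = A {p} Q - t ^ card Q"
      using prod_out_minus_power[OF Q(1,2)] by (simp add: raise_coeff_def)
    finally show "(\<Sum>j\<in>S - R. raise_coeff p j * A (S - {j}) {j} * (X R *
      (A R (insert p (S - {j}) - R) * G R + A (insert p R) (S - {j} - R) * (x p * G (insert p R))))) =
      X R * A R (S - R) * (A R {p} * G R * (1 - A (S - R) {p}) +
      x p * G (insert p R) * (A {p} (S - R) - t ^ (card S - card R)))"
      unfolding Q(3) Q_def[symmetric] by (simp add: distrib_left mult.assoc)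
  qed
  finally have v: "?v = (\<Sum>R\<in>Pow S. X R * A R (S - R) * (A R {p} * G R * (1 - A (S - R) {p}) +
      x p * G (insert p R) * (A {p} (S - R) - t ^ (card S - card R))))" .
  \<comment> \<open>The term with \<open>A (S - R) {p}\<close> that \<open>A_in\<close> produced in
    \<open>?v\<close> cancels against \<open>A S {p} * ?u\<close>.\<close>
  have "A S {p} * ?u + ?v = (\<Sum>R\<in>Pow S. A R (S - R) * X R * (A R {p} * G R +
      x p * G (insert p R) * (A {p} (S - R) - t ^ (card S - card R))))"
    unfolding v unfolding sum_distrib_left sum.distrib[symmetric]
  proof (rule sum.cong[OF refl])
    fix R assume "R \<in> Pow S"
    then have "finite R" "R \<union> (S - R) = S" using assms by (auto intro: finite_subset)
    then have "A S {p} = A R {p} * A (S - R) {p}"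
      using A_union_left[of R "S - R" "{p}"] assms by auto
    then show "A S {p} * (X R * (A R (S - R) * G R)) + X R * A R (S - R) *
      (A R {p} * G R * (1 - A (S - R) {p}) + x p * G (insert p R) * (A {p} (S - R) - t ^ (card S - card R))) =
      A R (S - R) * X R * (A R {p} * G R + x p * G (insert p R) * (A {p} (S - R) - t ^ (card S - card R)))"
      by (simp add: algebra_simps)
  qed
  \<comment> \<open>Writing \<open>A {p} (S - R) - t ^ k\<close> as
    \<open>(A {p} (S - R) - 1) + (1 - t ^ k)\<close> exposes the right-hand side of
    \<open>sum_raise\<close>.\<close>
  also have "\<dots> = (\<Sum>R\<in>Pow S. A R (S - R) * X R *
      (A R {p} * G R + x p * (A {p} (S - R) - 1) * G (insert p R))) +
    (\<Sum>R\<in>Pow S. A R (S - R) * X R * ((1 - t ^ (card S - card R)) * (x p * G (insert p R))))"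
    unfolding sum.distrib[symmetric] by (intro sum.cong refl) algebra
  also have "\<dots> = ?lhs"
    by (simp only: distrib_left[of "A _ _ * X _" "raise _ _ _"] sum.distrib sum_raise[OF assms])
  finally show ?thesis ..
qed

end

subsection \<open>Interpolation between tableaux and flags\<close>

lemma sum_Pow_interval_subset:
  fixes f :: "nat set \<Rightarrow> 'c::comm_monoid_add"
  shows "(\<Sum>R\<in>Pow {1..m}. if R \<subseteq> D then f R else 0) = (\<Sum>R\<in>Pow (D \<inter> {1..m}). f R)"
proof -
  have "(\<Sum>R\<in>Pow {1..m}. if R \<subseteq> D then f R else 0) = (\<Sum>R\<in>{R \<in> Pow {1..m}. R \<subseteq> D}. f R)"
    by (rule sum.inter_filter[symmetric]) simp
  also have "{R \<in> Pow {1..m}. R \<subseteq> D} = Pow (D \<inter> {1..m})" by auto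
  finally show ?thesis .
qed

context hall_littlewood
begin

text \<open>\<open>jump C E r\<close> collects the tableau factors of the entries \<open>E\<close> of a column to the right of
  the column \<open>C\<close>, when \<open>r\<close> further entries of that column are smaller than all of \<open>E\<close>.
  It vanishes if the two columns violate semistandardness at an element of \<open>E\<close>.\<close>

definition jump :: "nat set \<Rightarrow> nat set \<Rightarrow> nat \<Rightarrow> 'a" where
  "jump C E r = (\<Prod>b\<in>E - C. 1 - t ^ (card (C \<inter> {..<b}) - (r + card (E \<inter> {..<b}))))"

text \<open>\<open>kernel m\<close> interpolates between the tableau weights (\<open>m = 0\<close>) and the weights of
  flags of subsets (\<open>m = n\<close>): entries up to \<open>m\<close> are treated as in a flag.\<close>

definition kernel :: "nat \<Rightarrow> nat set \<Rightarrow> nat set \<Rightarrow> 'a" where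
  "kernel m C C' = (if C' \<inter> {..m} \<subseteq> C then A (C' \<inter> {..m}) (C \<inter> {..m} - C') else 0) *
     jump C (C' \<inter> {m<..}) (card (C' \<inter> {..m}))"

definition transfer :: "nat \<Rightarrow> nat \<Rightarrow> (nat set \<Rightarrow> 'a) \<Rightarrow> nat set \<Rightarrow> 'a" where
  "transfer m n F C = (\<Sum>C'\<in>Pow {1..n}. kernel m C C' * (X C' * F C'))"

text \<open>The intertwiner between \<open>transfer (p - 1)\<close> and \<open>transfer p\<close>:
  \<open>raise\<close> acts on the entries below \<open>p\<close>, while those above
  \<open>p\<close> stay fixed.\<close>

definition lift :: "nat \<Rightarrow> (nat set \<Rightarrow> 'a) \<Rightarrow> nat set \<Rightarrow> 'a" where
  "lift p G C = (if p \<in> C then G C else raise p (\<lambda>B. G (B \<union> (C \<inter> {p<..}))) (C \<inter> {..<p}))"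

lemma kernel_union:
  assumes "B \<subseteq> {..m}" "E \<subseteq> {m<..}"
  shows "kernel m C (B \<union> E) = (if B \<subseteq> C then A B (C \<inter> {..m} - B) else 0) * jump C E (card B)"
proof -
  have "(B \<union> E) \<inter> {..m} = B" "(B \<union> E) \<inter> {m<..} = E" using assms by force+
  moreover have "C \<inter> {..m} - (B \<union> E) = C \<inter> {..m} - B" using assms by force
  ultimately show ?thesis by (simp add: kernel_def)
qed

text \<open>Lying below all of \<open>E\<close>, the entry \<open>p\<close> contributes its own
  factor and counts as one more smaller entry for all others.\<close>

lemma jump_insert:
  assumes "finite E" "E \<subseteq> {p<..}"
  shows "jump C (insert p E) r =
    (if p \<in> C then 1 else 1 - t ^ (card (C \<inter> {..<p}) - r)) * jump C E (Suc r)"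
proof -
  have E: "card (insert p E \<inter> {..<b}) = Suc (card (E \<inter> {..<b}))" if "b \<in> E" for b
  proof -
    have "insert p E \<inter> {..<b} = insert p (E \<inter> {..<b})" "p \<notin> E" using that assms by auto
    then show ?thesis using assms by simp
  qed
  have p: "insert p E \<inter> {..<p} = {}" "p \<notin> E" using assms by auto
  have "insert p E - C = (if p \<in> C then E - C else insert p (E - C))" by auto
  moreover have "(\<Prod>b\<in>E - C. 1 - t ^ (card (C \<inter> {..<b}) - (r + card (insert p E \<inter> {..<b})))) = jump C E (Suc r)"
    unfolding jump_def using E by (intro prod.cong) simp_all
  ultimately show ?thesis using assms p by (simp add: jump_def[of C "insert p E"])
qed

lemma X_union: "finite B \<Longrightarrow> finite E \<Longrightarrow> B \<inter> E = {} \<Longrightarrow> X (B \<union> E) = X B * X E"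
  by (simp add: X_def prod.union_disjoint)

text \<open>Here \<open>p\<close> still follows the tableau rule: its absence from \<open>C\<close>
  costs a factor but does not forbid it in the next column.\<close>

lemma transfer_low:
  fixes n m :: nat
  defines "p \<equiv> Suc m"
  assumes "m < n" "C \<subseteq> {1..n}"
  shows "transfer m n F C = (\<Sum>E\<in>Pow {p<..n}. X E * (\<Sum>R\<in>Pow (C \<inter> {..<p}).
    A R (C \<inter> {..<p} - R) * X R * (jump C E (card R) * F (R \<union> E) +
    (if p \<in> C then 1 else 1 - t ^ (card (C \<inter> {..<p}) - card R)) *
    (x p * (jump C E (Suc (card R)) * F (insert p R \<union> E))))))"
proof -
  have C: "C \<inter> {1..m} = C \<inter> {..<p}" "C \<inter> {..m} = C \<inter> {..<p}"
    using assms by (auto simp: p_def)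
  have "transfer m n F C = (\<Sum>E\<in>Pow {p<..n}. \<Sum>R\<in>Pow {1..m}.
    kernel m C (R \<union> E) * (X (R \<union> E) * F (R \<union> E)) +
    kernel m C (R \<union> insert p E) * (X (R \<union> insert p E) * F (R \<union> insert p E)))"
    unfolding transfer_def p_def by (rule sum_Pow_interval_split[OF \<open>m < n\<close>])
  also have "\<dots> = (\<Sum>E\<in>Pow {p<..n}. X E * (\<Sum>R\<in>Pow {1..m}. if R \<subseteq> C then
    A R (C \<inter> {..<p} - R) * X R * (jump C E (card R) * F (R \<union> E) +
    (if p \<in> C then 1 else 1 - t ^ (card (C \<inter> {..<p}) - card R)) *
    (x p * (jump C E (Suc (card R)) * F (insert p R \<union> E)))) else 0))"
    unfolding sum_distrib_left
  proof (intro sum.cong refl)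
    fix E R assume "E \<in> Pow {p<..n}" "R \<in> Pow {1..m}"
    then have E: "finite E" "E \<subseteq> {p<..}" and R: "finite R" "R \<subseteq> {1..m}"
      by (auto intro: finite_subset)
    have K: "kernel m C (R \<union> E) = (if R \<subseteq> C then A R (C \<inter> {..<p} - R) else 0) * jump C E (card R)"
      "kernel m C (R \<union> insert p E) =
      (if R \<subseteq> C then A R (C \<inter> {..<p} - R) else 0) * jump C (insert p E) (card R)"
      unfolding C(2)[symmetric] using E R by (intro kernel_union; force simp: p_def)+
    have "R \<inter> E = {}" "R \<inter> insert p E = {}" "p \<notin> E"
      using E R by (force simp: p_def)+
    then have "X (R \<union> E) = X R * X E" "X (R \<union> insert p E) = X R * (x p * X E)"
      using E R by (simp_all add: X_union del: Un_insert_right) (simp add: X_def)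
    then show "kernel m C (R \<union> E) * (X (R \<union> E) * F (R \<union> E)) +
      kernel m C (R \<union> insert p E) * (X (R \<union> insert p E) * F (R \<union> insert p E)) =
      X E * (if R \<subseteq> C then
      A R (C \<inter> {..<p} - R) * X R * (jump C E (card R) * F (R \<union> E) +
      (if p \<in> C then 1 else 1 - t ^ (card (C \<inter> {..<p}) - card R)) *
      (x p * (jump C E (Suc (card R)) * F (insert p R \<union> E)))) else 0)"
      unfolding K jump_insert[OF E] by (simp add: algebra_simps)
  qed
  finally show ?thesis
    unfolding sum_Pow_interval_subset C .
qed

text \<open>Here \<open>p\<close> follows the flag rule, so it can occur in the next column only if
  it lies in \<open>C\<close>.\<close>

lemma transfer_high:
  fixes n m :: nat
  defines "p \<equiv> Suc m"
  assumes "m < n" "C \<subseteq> {1..n}"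
  shows "transfer p n F C = (\<Sum>E\<in>Pow {p<..n}. X E * (\<Sum>R\<in>Pow (C \<inter> {..<p}).
    X R * (A R (C \<inter> {..p} - R) * (jump C E (card R) * F (R \<union> E)) +
    (if p \<in> C then A (insert p R) (C \<inter> {..<p} - R) *
      (x p * (jump C E (Suc (card R)) * F (insert p R \<union> E))) else 0))))"
proof -
  have C: "C \<inter> {1..m} = C \<inter> {..<p}"
    using assms by (auto simp: p_def)
  have "transfer p n F C = (\<Sum>E\<in>Pow {p<..n}. \<Sum>R\<in>Pow {1..m}.
    kernel p C (R \<union> E) * (X (R \<union> E) * F (R \<union> E)) +
    kernel p C (R \<union> insert p E) * (X (R \<union> insert p E) * F (R \<union> insert p E)))"
    unfolding transfer_def p_def by (rule sum_Pow_interval_split[OF \<open>m < n\<close>])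
  also have "\<dots> = (\<Sum>E\<in>Pow {p<..n}. X E * (\<Sum>R\<in>Pow {1..m}. if R \<subseteq> C then
    X R * (A R (C \<inter> {..p} - R) * (jump C E (card R) * F (R \<union> E)) +
    (if p \<in> C then A (insert p R) (C \<inter> {..<p} - R) *
      (x p * (jump C E (Suc (card R)) * F (insert p R \<union> E))) else 0)) else 0))"
    unfolding sum_distrib_left
  proof (intro sum.cong refl)
    fix E R assume "E \<in> Pow {p<..n}" "R \<in> Pow {1..m}"
    then have E: "finite E" "E \<subseteq> {p<..}" and R: "finite R" "R \<subseteq> {1..m}" "p \<notin> R"
      by (auto intro: finite_subset simp: p_def)
    have "kernel p C (insert p R \<union> E) =
      (if insert p R \<subseteq> C then A (insert p R) (C \<inter> {..p} - insert p R) else 0) * jump C E (card (insert p R))"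
      using E R by (intro kernel_union; force simp: p_def)
    moreover have "C \<inter> {..p} - insert p R = C \<inter> {..<p} - R" by (auto simp: p_def)
    ultimately have K2: "kernel p C (R \<union> insert p E) =
      (if p \<in> C then if R \<subseteq> C then A (insert p R) (C \<inter> {..<p} - R) else 0 else 0) * jump C E (Suc (card R))"
      using R by simp
    have K1: "kernel p C (R \<union> E) = (if R \<subseteq> C then A R (C \<inter> {..p} - R) else 0) * jump C E (card R)"
      using E R by (intro kernel_union; force simp: p_def)
    have "R \<inter> E = {}" "R \<inter> insert p E = {}" "p \<notin> E"
      using E R by (force simp: p_def)+
    then have "X (R \<union> E) = X R * X E" "X (R \<union> insert p E) = X R * (x p * X E)"
      using E R by (simp_all add: X_union del: Un_insert_right) (simp add: X_def)
    then show "kernel p C (R \<union> E) * (X (R \<union> E) * F (R \<union> E)) +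
      kernel p C (R \<union> insert p E) * (X (R \<union> insert p E) * F (R \<union> insert p E)) =
      X E * (if R \<subseteq> C then
      X R * (A R (C \<inter> {..p} - R) * (jump C E (card R) * F (R \<union> E)) +
      (if p \<in> C then A (insert p R) (C \<inter> {..<p} - R) *
        (x p * (jump C E (Suc (card R)) * F (insert p R \<union> E))) else 0)) else 0)"
      unfolding K1 K2 by (simp add: algebra_simps)
  qed
  finally show ?thesis
    unfolding sum_Pow_interval_subset C .
qed

text \<open>The intertwining relation. For fixed entries \<open>E\<close> above \<open>p\<close> it
  is \<open>branch_in\<close> if \<open>p\<close> lies in \<open>C\<close>, and
  \<open>branch_out\<close> otherwise.\<close>

lemma transfer_lift:
  assumes "m < n" "C \<subseteq> {1..n}"
  shows "transfer m n (lift (Suc m) G) C = lift (Suc m) (transfer (Suc m) n G) C"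
proof -
  define p where "p = Suc m"
  define S where "S = C \<inter> {..<p}"
  define H where "H = C \<inter> {p<..}"
  \<comment> \<open>\<open>g E\<close> absorbs the tableau factor of the entries \<open>E\<close>.
    That factor depends on \<open>B\<close> only through its size and hence passes through
    \<open>raise\<close> by \<open>raise_card\<close>.\<close>
  define g where "g E B = jump C E (card B) * G (B \<union> E)" for E B
  have S: "finite S" "p \<notin> S" "S \<subseteq> {..<p}" by (auto simp: S_def)
  have low: "transfer m n (lift p G) C = (\<Sum>E\<in>Pow {p<..n}. X E * (\<Sum>R\<in>Pow S.
    A R (S - R) * X R * (raise p (g E) R +
    (if p \<in> C then 1 else 1 - t ^ (card S - card R)) * (x p * g E (insert p R)))))"
    unfolding transfer_low[OF assms, folded p_def] S_def[symmetric]
  proof (intro sum.cong refl arg_cong2[where f = "(*)"] arg_cong2[where f = "(+)"])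
    fix E R assume "E \<in> Pow {p<..n}" "R \<in> Pow S"
    then have E: "E \<subseteq> {p<..}" and R: "finite R" "R \<subseteq> {..<p}" "p \<notin> R"
      using S by (auto intro: finite_subset)
    then have "(R \<union> E) \<inter> {p<..} = E" "(R \<union> E) \<inter> {..<p} = R" "p \<notin> R \<union> E" by auto
    then have "lift p G (R \<union> E) = raise p (\<lambda>B. G (B \<union> E)) R"
      by (simp add: lift_def)
    then show "jump C E (card R) * lift p G (R \<union> E) = raise p (g E) R"
      using raise_card[OF R(1,3), of "jump C E" "\<lambda>B. G (B \<union> E)"] by (simp add: g_def[abs_def])
    show "jump C E (Suc (card R)) * lift p G (insert p R \<union> E) = g E (insert p R)"
      using R by (simp add: lift_def g_def)
  qed
  show ?thesis
  proof (cases "p \<in> C")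
    case True
    then have "C \<inter> {..p} = insert p S" by (auto simp: S_def)
    then have "transfer p n G C = (\<Sum>E\<in>Pow {p<..n}. X E * (\<Sum>R\<in>Pow S.
      X R * (A R (insert p S - R) * g E R + A (insert p R) (S - R) * (x p * g E (insert p R)))))"
      using True S unfolding transfer_high[OF assms, folded p_def] S_def[symmetric]
      by (intro sum.cong refl arg_cong2[where f = "(*)"] arg_cong2[where f = "(+)"])
         (auto simp: g_def card_insert_if finite_subset)
    also have "\<dots> = transfer m n (lift p G) C"
      unfolding low using True by (simp add: branch_in[OF S(1,2)])
    finally show ?thesis using True by (simp add: lift_def p_def)
  next
    case False
    \<comment> \<open>\<open>T E B\<close> is the share of \<open>E\<close> in the transfer out of
      \<open>B \<union> H\<close>. \<open>raise\<close> needs it for \<open>B = S\<close> and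
      \<open>B = insert p (S - {j})\<close>, two kinds of sets that agree in size.\<close>
    define T where "T E B = (\<Sum>R\<in>Pow (B - {p}). X R * (A R (B - R) * g E R +
      (if p \<in> B then A (insert p R) (B - {p} - R) * (x p * g E (insert p R)) else 0)))" for E B
    have high: "transfer p n G (B \<union> H) = (\<Sum>E\<in>Pow {p<..n}. X E * T E B)"
      if B: "B \<subseteq> {1..p}" and card: "card B = card S" for B
    proof -
      have BH: "(B \<union> H) \<inter> {..p} = B" "(B \<union> H) \<inter> {..<p} = B - {p}" "p \<in> B \<union> H \<longleftrightarrow> p \<in> B"
        using B by (auto simp: H_def)
      have sub: "B \<union> H \<subseteq> {1..n}" using assms B by (auto simp: H_def p_def)
      have "finite B" using B by (rule finite_subset) simp
      \<comment> \<open>Both \<open>B\<close> and \<open>S\<close> lie entirely below any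
        \<open>b > p\<close>, so equal size gives equal counts below \<open>b\<close>.\<close>
      have jump: "jump (B \<union> H) E r = jump C E r" if E: "E \<subseteq> {p<..n}" for E r
        unfolding jump_def
      proof (rule prod.cong)
        show "E - (B \<union> H) = E - C" using E B by (force simp: H_def)
        fix b assume "b \<in> E - C"
        then have b: "p < b" using E by auto
        have "(B \<union> H) \<inter> {..<b} = B \<union> (H \<inter> {..<b})" "C \<inter> {..<b} = S \<union> (H \<inter> {..<b})"
          using B b False by (auto simp: S_def H_def) (metis nat_neq_iff)
        moreover have "card (B \<union> (H \<inter> {..<b})) = card B + card (H \<inter> {..<b})"
          using B \<open>finite B\<close> by (intro card_Un_disjoint) (auto simp: H_def)
        moreover have "card (S \<union> (H \<inter> {..<b})) = card S + card (H \<inter> {..<b})"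
          using S by (intro card_Un_disjoint) (auto simp: H_def)
        ultimately have "card ((B \<union> H) \<inter> {..<b}) = card (C \<inter> {..<b})"
          using card by simp
        then show "1 - t ^ (card ((B \<union> H) \<inter> {..<b}) - (r + card (E \<inter> {..<b}))) =
          1 - t ^ (card (C \<inter> {..<b}) - (r + card (E \<inter> {..<b})))" by simp
      qed
      show ?thesis
        unfolding transfer_high[OF assms(1) sub, folded p_def] BH T_def
      proof (intro sum.cong refl arg_cong2[where f = "(*)"] arg_cong2[where f = "(+)"])
        fix E R assume E: "E \<in> Pow {p<..n}" and R: "R \<in> Pow (B - {p})"
        show "jump (B \<union> H) E (card R) * G (R \<union> E) = g E R"
          using E jump by (simp add: g_def)
        have "finite R" using R \<open>finite B\<close> by (auto intro: finite_subset)
        then show "(if p \<in> B then A (insert p R) (B - {p} - R) *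
            (x p * (jump (B \<union> H) E (Suc (card R)) * G (insert p R \<union> E))) else 0) =
          (if p \<in> B then A (insert p R) (B - {p} - R) * (x p * g E (insert p R)) else 0)"
          using E R jump by (auto simp: g_def card_insert_if)
      qed
    qed
    have SH: "C \<inter> {..<p} = S" "C \<inter> {p<..} = H" by (auto simp: S_def H_def)
    have "S \<subseteq> {1..p}" using assms by (auto simp: S_def)
    then have "transfer p n G (S \<union> H) = (\<Sum>E\<in>Pow {p<..n}. X E * T E S)"
      by (intro high) auto
    moreover have "transfer p n G (insert p (S - {j}) \<union> H) =
      (\<Sum>E\<in>Pow {p<..n}. X E * T E (insert p (S - {j})))" if "j \<in> S" for j
      using \<open>S \<subseteq> {1..p}\<close> that S card_Suc_Diff1[OF S(1) that] by (intro high) (auto simp: p_def)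
    ultimately have "lift p (transfer p n G) C = raise p (\<lambda>B. \<Sum>E\<in>Pow {p<..n}. X E * T E B) S"
      using False by (simp add: lift_def SH raise_def cong: sum.cong)
    also have "\<dots> = (\<Sum>E\<in>Pow {p<..n}. X E * raise p (T E) S)"
      by (rule raise_sum)
    also have "\<dots> = transfer m n (lift p G) C"
      unfolding low
    proof (intro sum.cong refl arg_cong2[where f = "(*)"])
      fix E
      have "insert p (S - {j}) - {p} = S - {j}" for j using S by auto
      then have T: "T E (insert p (S - {j})) = (\<Sum>R\<in>Pow (S - {j}). X R *
        (A R (insert p (S - {j}) - R) * g E R + A (insert p R) (S - {j} - R) * (x p * g E (insert p R))))" for j
        by (simp add: T_def)
      have "T E S = (\<Sum>R\<in>Pow S. X R * (A R (S - R) * g E R))"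
        using S by (simp add: T_def)
      then show "raise p (T E) S = (\<Sum>R\<in>Pow S. A R (S - R) * X R * (raise p (g E) R +
        (if p \<in> C then 1 else 1 - t ^ (card S - card R)) * (x p * g E (insert p R))))"
        using False unfolding raise_def[of p "T E"] T by (simp add: branch_out[OF S(1,2)])
    qed
    finally show ?thesis by (simp add: p_def)
  qed
qed

text \<open>Empty columns count as steps, so \<open>k\<close> only bounds the number of nonempty
  columns. This is why sums over \<open>part1 lam \<le> k\<close> appear below.\<close>

primrec chains :: "nat \<Rightarrow> nat \<Rightarrow> nat \<Rightarrow> nat set \<Rightarrow> 'a" where
  "chains m n 0 C = 1"
| "chains m n (Suc k) C = transfer m n (chains m n k) C"

lemma transfer_cong: "(\<And>C'. C' \<subseteq> {1..n} \<Longrightarrow> F C' = G C') \<Longrightarrow> transfer m n F C = transfer m n G C"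
  unfolding transfer_def by (intro sum.cong) auto

text \<open>\<open>lift\<close> fixes the constant 1 because \<open>raise\<close> does, and
  \<open>transfer_lift\<close> carries the relation through each further step.\<close>

lemma chains_lift:
  assumes "m < n" "C \<subseteq> {1..n}"
  shows "chains m n k C = lift (Suc m) (chains (Suc m) n k) C"
  using assms(2)
proof (induction k arbitrary: C)
  case 0
  show ?case by (simp add: lift_def raise_const_one)
next
  case (Suc k)
  have "chains m n (Suc k) C = transfer m n (lift (Suc m) (chains (Suc m) n k)) C"
    unfolding chains.simps by (rule transfer_cong) (rule Suc.IH)
  also have "\<dots> = lift (Suc m) (transfer (Suc m) n (chains (Suc m) n k)) C"
    by (rule transfer_lift[OF assms(1) Suc.prems])
  also have "transfer (Suc m) n (chains (Suc m) n k) = chains (Suc m) n (Suc k)"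
    by (simp add: fun_eq_iff)
  finally show ?case .
qed

text \<open>A column that contains every entry is left alone by each \<open>lift\<close>, so its
  value is the same along the whole interpolation.\<close>

lemma chains_full:
  assumes "m \<le> n"
  shows "chains m n k {1..n} = chains 0 n k {1..n}"
  using assms
proof (induction m)
  case (Suc m)
  then have "chains m n k {1..n} = chains (Suc m) n k {1..n}"
    using chains_lift[of m n "{1..n}" k] by (simp add: lift_def)
  then show ?case using Suc by simp
qed simp

end

subsection \<open>Hall-Littlewood polynomials as sums over flags\<close>

lemma map_permutes_upt:
  "(\<lambda>w. map w [1..<Suc n]) ` {w. w permutes {1..n}} = permutations_of_set {1..n}"
  and inj_on_map_permutes_upt: "inj_on (\<lambda>w. map w [1..<Suc n]) {w. w permutes {1..n}}"
proof -
  have upt: "set [1..<Suc n] = {1..n}" by auto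
  show inj: "inj_on (\<lambda>w. map w [1..<Suc n]) {w. w permutes {1..n}}"
  proof (rule inj_onI)
    fix w w' assume w: "w \<in> {w. w permutes {1..n}}" "w' \<in> {w. w permutes {1..n}}"
      and "map w [1..<Suc n] = map w' [1..<Suc n]"
    then have "w i = w' i" if "i \<in> {1..n}" for i
      using that unfolding map_eq_conv upt by blast
    then show "w = w'" using w by (metis ext mem_Collect_eq permutes_not_in)
  qed
  have "map w [1..<Suc n] \<in> permutations_of_set {1..n}" if "w permutes {1..n}" for w
    unfolding permutations_of_set_def mem_Collect_eq set_map upt distinct_map
    using that permutes_image permutes_inj_on by auto
  then have "(\<lambda>w. map w [1..<Suc n]) ` {w. w permutes {1..n}} \<subseteq> permutations_of_set {1..n}"
    by blast
  moreover have "card ((\<lambda>w. map w [1..<Suc n]) ` {w. w permutes {1..n}}) = fact n"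
    unfolding card_image[OF inj] by (rule card_permutations) simp_all
  ultimately show "(\<lambda>w. map w [1..<Suc n]) ` {w. w permutes {1..n}} = permutations_of_set {1..n}"
    by (intro card_subset_eq finite_permutations_of_set) simp_all
qed

text \<open>Every word is cut after \<open>r\<close> letters, and \<open>R\<close> is the set of
  letters of its first piece.\<close>

lemma sum_permutations_of_set_split:
  fixes f :: "'b list \<Rightarrow> 'c::comm_monoid_add"
  assumes "finite S" "r \<le> card S"
  shows "(\<Sum>ws\<in>permutations_of_set S. f ws) =
    (\<Sum>R\<in>{R \<in> Pow S. card R = r}. \<Sum>us\<in>permutations_of_set R. \<Sum>vs\<in>permutations_of_set (S - R). f (us @ vs))"
proof -
  have len: "length ws = card S" if "ws \<in> permutations_of_set S" for ws
    using that by (auto simp: permutations_of_set_def distinct_card)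
  have lenr: "length us = card R" if "set us = R" "distinct us" for us and R :: "'b set"
    using that by (auto simp: distinct_card)
  have disj: "set (take r ws) \<inter> set (drop r ws) = {}" "set (take r ws) \<union> set (drop r ws) = set ws"
    if "distinct ws" for ws :: "'b list"
    using that by (metis append_take_drop_id distinct_append, metis append_take_drop_id set_append)
  have "(\<Sum>ws\<in>permutations_of_set S. f ws) = (\<Sum>(R, us, vs)\<in>(SIGMA R:{R \<in> Pow S. card R = r}.
    permutations_of_set R \<times> permutations_of_set (S - R)). f (us @ vs))"
  proof (rule sum.reindex_bij_witness[where i = "\<lambda>(R, us, vs). us @ vs"
        and j = "\<lambda>ws. (set (take r ws), take r ws, drop r ws)"])
    fix ws assume ws: "ws \<in> permutations_of_set S"
    then have "distinct ws" "set ws = S" by (auto simp: permutations_of_set_def)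
    moreover have "card (set (take r ws)) = r"
      using ws len[OF ws] assms by (simp add: distinct_card permutations_of_set_def)
    ultimately show "(set (take r ws), take r ws, drop r ws) \<in> (SIGMA R:{R \<in> Pow S. card R = r}.
      permutations_of_set R \<times> permutations_of_set (S - R))"
      using disj[of ws] by (auto simp: permutations_of_set_def)
  qed (auto simp: permutations_of_set_def lenr)
  also have "\<dots> = (\<Sum>R\<in>{R \<in> Pow S. card R = r}. \<Sum>us\<in>permutations_of_set R. \<Sum>vs\<in>permutations_of_set (S - R). f (us @ vs))"
    using assms by (subst sum.Sigma[symmetric]) (simp_all add: sum.cartesian_product)
  finally show ?thesis .
qed

definition bounded_parts :: "nat \<Rightarrow> nat \<Rightarrow> nat list set" where
  "bounded_parts N k = {lam. length lam = N \<and> sorted_wrt (\<ge>) lam \<and> set lam \<subseteq> {..k}}"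

lemma finite_bounded_parts [simp]: "finite (bounded_parts N k)"
  by (rule finite_subset[OF _ finite_lists_length_eq[of "{..k}" N]]) (auto simp: bounded_parts_def)

lemma bounded_parts_0: "bounded_parts N 0 = {replicate N 0}"
  by (auto simp: bounded_parts_def sorted_wrt_iff_nth_less intro!: replicate_eqI)

lemma sorted_ge_filter_pos:
  "sorted_wrt (\<ge>) (lam :: nat list) \<Longrightarrow>
    filter ((<) 0) lam @ replicate (length lam - length (filter ((<) 0) lam)) 0 = lam"
proof (induction lam)
  case (Cons l lam)
  show ?case
  proof (cases "l = 0")
    case True
    then have "\<forall>m\<in>set lam. m = 0" using Cons.prems by auto
    then have "filter ((<) 0) lam = []" "lam = replicate (length lam) 0"
      by (auto intro!: replicate_eqI)
    then show ?thesis using True by simp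
  qed (use Cons in \<open>simp add: Suc_diff_le length_filter_le\<close>)
qed simp

text \<open>Here \<open>r\<close> is the number of positive parts; lowering each of them by one
  leaves \<open>mu\<close>.\<close>

lemma sum_bounded_parts_Suc:
  fixes f :: "nat list \<Rightarrow> 'c::comm_monoid_add"
  shows "(\<Sum>lam\<in>bounded_parts N (Suc k). f lam) =
    (\<Sum>r\<le>N. \<Sum>mu\<in>bounded_parts r k. f (map Suc mu @ replicate (N - r) 0))"
proof -
  have filter: "filter ((<) 0) (map Suc mu @ replicate m 0) = map Suc mu" for mu m
    by (induction mu) simp_all
  have "(\<Sum>lam\<in>bounded_parts N (Suc k). f lam) =
    (\<Sum>(r, mu)\<in>(SIGMA r:{..N}. bounded_parts r k). f (map Suc mu @ replicate (N - r) 0))"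
  proof (rule sum.reindex_bij_witness[where i = "\<lambda>(r, mu). map Suc mu @ replicate (N - r) 0"
        and j = "\<lambda>lam. (length (filter ((<) 0) lam), map (\<lambda>l. l - 1) (filter ((<) 0) lam))"])
    fix lam assume lam: "lam \<in> bounded_parts N (Suc k)"
    have "map Suc (map (\<lambda>l. l - 1) (filter ((<) 0) lam)) = filter ((<) 0) lam"
      by (induction lam) auto
    then show eq: "(case (length (filter ((<) 0) lam), map (\<lambda>l. l - 1) (filter ((<) 0) lam)) of
        (r, mu) \<Rightarrow> map Suc mu @ replicate (N - r) 0) = lam"
      using lam sorted_ge_filter_pos[of lam] by (simp add: bounded_parts_def)
    show "(length (filter ((<) 0) lam), map (\<lambda>l. l - 1) (filter ((<) 0) lam)) \<in> (SIGMA r:{..N}. bounded_parts r k)"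
    proof -
      have "sorted_wrt (\<lambda>a b. b - 1 \<le> a - 1) (filter ((<) 0) lam)"
        using lam by (auto simp: bounded_parts_def intro!: sorted_wrt_filter intro: sorted_wrt_mono_rel[of _ "(\<ge>)"])
      then show ?thesis
        using lam length_filter_le[of "(<) 0" lam] by (force simp: bounded_parts_def sorted_wrt_map)
    qed
    show "(case (length (filter ((<) 0) lam), map (\<lambda>l. l - 1) (filter ((<) 0) lam)) of
        (r, mu) \<Rightarrow> f (map Suc mu @ replicate (N - r) 0)) = f lam"
      using eq by simp
  next
    fix p assume "p \<in> (SIGMA r:{..N}. bounded_parts r k)"
    then obtain r mu where p: "p = (r, mu)" and r: "r \<le> N" and mu: "mu \<in> bounded_parts r k" by auto
    show "(\<lambda>lam. (length (filter ((<) 0) lam), map (\<lambda>l. l - 1) (filter ((<) 0) lam)))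
       (case p of (r, mu) \<Rightarrow> map Suc mu @ replicate (N - r) 0) = p"
      using mu unfolding p prod.case filter by (simp add: bounded_parts_def comp_def)
    show "(case p of (r, mu) \<Rightarrow> map Suc mu @ replicate (N - r) 0) \<in> bounded_parts N (Suc k)"
      using mu r unfolding p by (auto simp: bounded_parts_def sorted_wrt_append sorted_wrt_map)
        (auto simp: sorted_wrt_iff_nth_less)
  qed
  also have "\<dots> = (\<Sum>r\<le>N. \<Sum>mu\<in>bounded_parts r k. f (map Suc mu @ replicate (N - r) 0))"
    by (rule sum.Sigma[symmetric]) auto
  finally show ?thesis .
qed

lemma partitions_le_part1:
  "{lam \<in> partitions_le n. part1 lam \<le> k} = bounded_parts n k"
proof -
  have "part1 lam \<le> k \<longleftrightarrow> set lam \<subseteq> {..k}" if "sorted_wrt (\<ge>) lam" for lam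
    using that by (cases lam) (auto simp: part1_def intro: order_trans)
  then show ?thesis unfolding partitions_le_def bounded_parts_def by blast
qed

context hall_littlewood
begin

fun word_weight :: "nat list \<Rightarrow> 'a" where
  "word_weight [] = 1"
| "word_weight (w # ws) = A {w} (set ws) * word_weight ws"

definition word_monomial :: "nat list \<Rightarrow> nat list \<Rightarrow> 'a" where
  "word_monomial ws lam = (\<Prod>(w, l)\<leftarrow>zip ws lam. x w ^ l)"

definition t_fact :: "nat \<Rightarrow> 'a" where
  "t_fact m = (\<Prod>i=1..m. (1 - t ^ i) / (1 - t))"

text \<open>The Hall-Littlewood polynomial in the variables indexed by \<open>S\<close>. Words on
  \<open>S\<close> replace permutations so that one can recurse on subsets.\<close>

definition HL :: "nat set \<Rightarrow> nat list \<Rightarrow> 'a" where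
  "HL S lam = (\<Sum>ws\<in>permutations_of_set S. word_monomial ws lam * word_weight ws) / v_lam lam t"

lemma t_fact_nonzero: "t_fact m \<noteq> 0"
  using t_power_neq_1 t_neq_1 by (force simp: t_fact_def)

lemma word_weight_append:
  "distinct (us @ vs) \<Longrightarrow> word_weight (us @ vs) = word_weight us * word_weight vs * A (set us) (set vs)"
proof (induction us)
  case (Cons u us)
  have "A {u} (set us \<union> set vs) = A {u} (set us) * A {u} (set vs)"
    using Cons.prems by (simp add: A_def prod.union_disjoint)
  moreover have "A (insert u (set us)) (set vs) = A {u} (set vs) * A (set us) (set vs)"
    using Cons.prems by (intro A_insert_left) auto
  ultimately show ?case using Cons by simp
qed simp

text \<open>Summation over the first letter is \<open>sum_prod_out\<close>, so each letter yields
  one factor of the t-factorial.\<close>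

lemma sum_word_weight:
  "finite S \<Longrightarrow> (\<Sum>ws\<in>permutations_of_set S. word_weight ws) = t_fact (card S)"
proof (induction "card S" arbitrary: S)
  case 0
  then show ?case by (simp add: t_fact_def)
next
  case (Suc m)
  then have S: "S \<noteq> {}" "finite S" by auto
  have "(\<Sum>ws\<in>permutations_of_set S. word_weight ws) =
    (\<Sum>s\<in>S. \<Sum>ws\<in>(#) s ` permutations_of_set (S - {s}). word_weight ws)"
    unfolding permutations_of_set_nonempty[OF S(1)] using S by (intro sum.UNION_disjoint) auto
  also have "\<dots> = (\<Sum>s\<in>S. A {s} (S - {s}) * t_fact m)"
  proof (rule sum.cong[OF refl])
    fix s assume s: "s \<in> S"
    have "(\<Sum>ws\<in>(#) s ` permutations_of_set (S - {s}). word_weight ws) =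
      (\<Sum>ws\<in>permutations_of_set (S - {s}). A {s} (S - {s}) * word_weight ws)"
      by (subst sum.reindex) (auto intro!: sum.cong simp: permutations_of_set_def)
    also have "\<dots> = A {s} (S - {s}) * t_fact m"
      using Suc(1)[of "S - {s}"] Suc(2)[symmetric] s S by (simp add: sum_distrib_left[symmetric])
    finally show "(\<Sum>ws\<in>(#) s ` permutations_of_set (S - {s}). word_weight ws) = A {s} (S - {s}) * t_fact m" .
  qed
  also have "\<dots> = (1 - t ^ Suc m) / (1 - t) * t_fact m"
    using sum_prod_out[OF S(2)] Suc(2) by (simp add: A_def sum_distrib_right[symmetric])
  also have "\<dots> = t_fact (card S)"
    unfolding Suc(2)[symmetric] by (simp add: t_fact_def)
  finally show ?case .
qed

lemma word_monomial_append:
  "length us = length lam \<Longrightarrow> word_monomial (us @ vs) (lam @ mu) = word_monomial us lam * word_monomial vs mu"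
  by (simp add: word_monomial_def)

lemma word_monomial_replicate_0: "length vs = m \<Longrightarrow> word_monomial vs (replicate m 0) = 1"
  by (induction vs arbitrary: m) (auto simp: word_monomial_def)

lemma word_monomial_Suc:
  "length us = length mu \<Longrightarrow> distinct us \<Longrightarrow> word_monomial us (map Suc mu) = X (set us) * word_monomial us mu"
  by (induction us mu rule: list_induct2) (auto simp: word_monomial_def X_def)

text \<open>The positive parts keep the multiplicities of \<open>mu\<close>, and the zeros form one
  further block of size \<open>m\<close>.\<close>

lemma v_lam_decompose:
  "v_lam (map Suc mu @ replicate m 0) t = v_lam mu t * t_fact m"
proof -
  define f where "f = count_list (map Suc mu @ replicate m 0)"
  have f_Suc: "f (Suc l) = count_list mu l" for l
    unfolding f_def by (induction mu) (auto simp: count_list_0_iff)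
  have "count_list (replicate m 0) 0 = m"
    by (induction m) auto
  then have f_0: "f 0 = m"
    unfolding f_def by (induction mu) auto
  \<comment> \<open>For \<open>m = 0\<close> the value 0 does not occur; this agrees with
    \<open>t_fact 0 = 1\<close>.\<close>
  have "set (map Suc mu @ replicate m 0) = Suc ` set mu \<union> (if m = 0 then {} else {0})"
    by auto
  then have "v_lam (map Suc mu @ replicate m 0) t =
      (\<Prod>l\<in>Suc ` set mu \<union> (if m = 0 then {} else {0}). t_fact (f l))"
    unfolding v_lam_def t_fact_def f_def by (rule prod.cong) simp
  also have "\<dots> = (\<Prod>l\<in>Suc ` set mu. t_fact (f l)) * t_fact m"
    by (subst prod.union_disjoint) (auto simp: f_0 t_fact_def)
  also have "(\<Prod>l\<in>Suc ` set mu. t_fact (f l)) = v_lam mu t"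
    by (simp add: prod.reindex f_Suc v_lam_def t_fact_def)
  finally show ?thesis .
qed

text \<open>Let \<open>R\<close> hold the first \<open>r\<close> letters of a word, those with
  positive exponent. They contribute \<open>X R\<close>, the pairs between \<open>R\<close> and the
  rest contribute \<open>A R (S - R)\<close>, and the words on the rest sum to a t-factorial that
  cancels the one from the zeros in \<open>v_lam\<close>.\<close>

lemma HL_decompose:
  assumes "finite S" "length mu = r" "r \<le> card S"
  shows "HL S (map Suc mu @ replicate (card S - r) 0) =
    (\<Sum>R\<in>{R \<in> Pow S. card R = r}. A R (S - R) * (X R * HL R mu))"
proof -
  let ?m = "card S - r"
  have "(\<Sum>ws\<in>permutations_of_set S. word_monomial ws (map Suc mu @ replicate ?m 0) * word_weight ws) =
    (\<Sum>R\<in>{R \<in> Pow S. card R = r}. \<Sum>us\<in>permutations_of_set R. \<Sum>vs\<in>permutations_of_set (S - R).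
      word_monomial (us @ vs) (map Suc mu @ replicate ?m 0) * word_weight (us @ vs))"
    by (rule sum_permutations_of_set_split) fact+
  also have "\<dots> = (\<Sum>R\<in>{R \<in> Pow S. card R = r}. A R (S - R) * (X R *
    (\<Sum>us\<in>permutations_of_set R. word_monomial us mu * word_weight us)) * t_fact ?m)"
  proof (rule sum.cong[OF refl])
    fix R assume "R \<in> {R \<in> Pow S. card R = r}"
    then have R: "R \<subseteq> S" "card R = r" "finite R" using assms by (auto intro: finite_subset)
    have cardD: "card (S - R) = ?m" using R by (simp add: card_Diff_subset)
    have "word_monomial (us @ vs) (map Suc mu @ replicate ?m 0) * word_weight (us @ vs) =
      A R (S - R) * X R * (word_monomial us mu * word_weight us) * word_weight vs"
      if us: "us \<in> permutations_of_set R" and vs: "vs \<in> permutations_of_set (S - R)" for us vs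
    proof -
      have u: "set us = R" "distinct us" "length us = length mu"
        using us R assms by (auto simp: permutations_of_set_def distinct_card)
      have v: "set vs = S - R" "distinct vs" "length vs = ?m"
        using vs cardD by (auto simp: permutations_of_set_def) (metis distinct_card)
      have "word_weight (us @ vs) = word_weight us * word_weight vs * A R (S - R)"
        using u v by (subst word_weight_append) auto
      then show ?thesis
        using u v by (simp add: word_monomial_append word_monomial_replicate_0 word_monomial_Suc)
    qed
    then have "(\<Sum>us\<in>permutations_of_set R. \<Sum>vs\<in>permutations_of_set (S - R).
      word_monomial (us @ vs) (map Suc mu @ replicate ?m 0) * word_weight (us @ vs)) =
      (\<Sum>us\<in>permutations_of_set R. \<Sum>vs\<in>permutations_of_set (S - R).
      A R (S - R) * X R * (word_monomial us mu * word_weight us) * word_weight vs)"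
      by (intro sum.cong refl)
    also have "\<dots> = A R (S - R) * (X R *
    (\<Sum>us\<in>permutations_of_set R. word_monomial us mu * word_weight us)) * t_fact ?m"
      unfolding sum_distrib_left[symmetric] sum_distrib_right[symmetric]
      using sum_word_weight[of "S - R"] assms cardD by (simp add: mult.assoc)
    finally show "(\<Sum>us\<in>permutations_of_set R. \<Sum>vs\<in>permutations_of_set (S - R).
      word_monomial (us @ vs) (map Suc mu @ replicate ?m 0) * word_weight (us @ vs)) =
      A R (S - R) * (X R *
    (\<Sum>us\<in>permutations_of_set R. word_monomial us mu * word_weight us)) * t_fact ?m" .
  qed
  finally show ?thesis
    using t_fact_nonzero[of ?m]
    by (simp add: HL_def v_lam_decompose sum_divide_distrib[symmetric] sum_distrib_right[symmetric])
qed

lemma HL_replicate_0: "finite S \<Longrightarrow> HL S (replicate (card S) 0) = 1"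
proof -
  assume S: "finite S"
  have "word_monomial ws (replicate (card S) 0) = 1" if "ws \<in> permutations_of_set S" for ws
    using that by (intro word_monomial_replicate_0) (auto simp: permutations_of_set_def distinct_card)
  moreover have "v_lam (replicate (card S) 0) t = t_fact (card S)"
    using v_lam_decompose[of "[]" "card S"] by (simp add: v_lam_def)
  ultimately show ?thesis
    using sum_word_weight[OF S] t_fact_nonzero[of "card S"] by (simp add: HL_def)
qed

text \<open>At \<open>m = n\<close> no entry exceeds \<open>m\<close>, so \<open>jump\<close> is an
  empty product and only the flag rule remains.\<close>

lemma transfer_flag:
  assumes "C \<subseteq> {1..n}"
  shows "transfer n n F C = (\<Sum>R\<in>Pow C. A R (C - R) * (X R * F R))"
proof -
  have "kernel n C R = (if R \<subseteq> C then A R (C - R) else 0)" if "R \<subseteq> {1..n}" for R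
  proof -
    have "R \<inter> {..n} = R" "C \<inter> {..n} = C" "R \<inter> {n<..} = {}" using that assms by auto
    then show ?thesis by (simp add: kernel_def jump_def)
  qed
  then have "transfer n n F C = (\<Sum>R\<in>Pow {1..n}. if R \<subseteq> C then A R (C - R) * (X R * F R) else 0)"
    unfolding transfer_def by (intro sum.cong) auto
  also have "C \<inter> {1..n} = C" using assms by auto
  then have "(\<Sum>R\<in>Pow {1..n}. if R \<subseteq> C then A R (C - R) * (X R * F R) else 0) =
    (\<Sum>R\<in>Pow C. A R (C - R) * (X R * F R))"
    by (simp only: sum_Pow_interval_subset)
  finally show ?thesis .
qed

text \<open>\<open>HL_decompose\<close> is one flag step, with \<open>R\<close> the letters of
  positive exponent. The sum over the number \<open>r\<close> of positive parts merges with that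
  over subsets of size \<open>r\<close> into one over all subsets.\<close>

lemma chains_eq_sum_HL:
  assumes "C \<subseteq> {1..n}"
  shows "chains n n k C = (\<Sum>lam\<in>bounded_parts (card C) k. HL C lam)"
  using assms
proof (induction k arbitrary: C)
  case 0
  then have "finite C" by (auto intro: finite_subset)
  then show ?case by (simp add: bounded_parts_0 HL_replicate_0)
next
  case (Suc k)
  then have C: "finite C" by (auto intro: finite_subset)
  have "(\<Sum>lam\<in>bounded_parts (card C) (Suc k). HL C lam) =
    (\<Sum>r\<le>card C. \<Sum>mu\<in>bounded_parts r k. \<Sum>R\<in>{R \<in> Pow C. card R = r}. A R (C - R) * (X R * HL R mu))"
    unfolding sum_bounded_parts_Suc
    by (intro sum.cong refl HL_decompose C) (auto simp: bounded_parts_def)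
  also have "\<dots> = (\<Sum>r\<le>card C. \<Sum>R\<in>{R \<in> Pow C. card R = r}. A R (C - R) * (X R * chains n n k R))"
  proof (rule sum.cong[OF refl])
    fix r
    show "(\<Sum>mu\<in>bounded_parts r k. \<Sum>R\<in>{R \<in> Pow C. card R = r}. A R (C - R) * (X R * HL R mu)) =
      (\<Sum>R\<in>{R \<in> Pow C. card R = r}. A R (C - R) * (X R * chains n n k R))"
      using Suc.prems by (subst sum.swap) (auto simp: Suc.IH subset_trans sum_distrib_left intro!: sum.cong)
  qed
  also have "\<dots> = (\<Sum>R\<in>Pow C. A R (C - R) * (X R * chains n n k R))"
    by (rule sum.group) (use C in \<open>auto simp: card_mono\<close>)
  also have "\<dots> = chains n n (Suc k) C"
    using transfer_flag[OF Suc.prems] by simp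
  finally show ?case ..
qed

lemma word_weight_map:
  assumes "inj_on w {m..<k}" "m \<le> k"
  shows "word_weight (map w [m..<k]) = (\<Prod>i\<in>{m..<k}. \<Prod>j\<in>{i<..<k}. a (x (w i)) (x (w j)))"
  using assms(2,1)
proof (induction m rule: inc_induct)
  case (step m)
  have "inj_on w {Suc m..<k}" using step.prems by (rule inj_on_subset) auto
  moreover have "A {w m} (w ` {Suc m..<k}) = (\<Prod>j\<in>{Suc m..<k}. a (x (w m)) (x (w j)))"
    using \<open>inj_on w {Suc m..<k}\<close> by (simp add: A_def prod.reindex)
  moreover have "{Suc m..<k} = {m<..<k}" "{m..<k} = insert m {Suc m..<k}" using step.hyps by auto
  ultimately show ?case using step by (simp add: upt_conv_Cons del: upt_Suc)
qed simp

lemma HL_P_eq_HL: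
  assumes "length lam = n"
  shows "HL_P n x t lam = HL {1..n} lam"
proof -
  have "(\<Prod>k\<in>{1..n}. x (w k) ^ (lam ! (k - 1))) *
    (\<Prod>(i, j)\<in>{(i, j). 1 \<le> i \<and> i < j \<and> j \<le> n}. (x (w i) - t * x (w j)) / (x (w i) - x (w j))) =
    word_monomial (map w [1..<Suc n]) lam * word_weight (map w [1..<Suc n])"
    if w: "w permutes {1..n}" for w
  proof -
    have "word_monomial (map w [1..<Suc n]) lam = (\<Prod>k<n. x (w (Suc k)) ^ (lam ! k))"
      using assms by (simp add: word_monomial_def prod.list_conv_set_nth atLeast0LessThan del: upt_Suc)
    also have "\<dots> = (\<Prod>k\<in>{1..n}. x (w k) ^ (lam ! (k - 1)))"
      by (rule prod.reindex_bij_witness[where i = "\<lambda>k. k - 1" and j = Suc]) auto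
    finally have 1: "word_monomial (map w [1..<Suc n]) lam = \<dots>" .
    have "inj_on w {1..<Suc n}" using w by (meson permutes_inj_on)
    then have "word_weight (map w [1..<Suc n]) =
      (\<Prod>i\<in>{1..<Suc n}. \<Prod>j\<in>{i<..<Suc n}. a (x (w i)) (x (w j)))"
      by (rule word_weight_map) simp
    also have "\<dots> = (\<Prod>(i, j)\<in>(SIGMA i:{1..<Suc n}. {i<..<Suc n}). a (x (w i)) (x (w j)))"
      by (rule prod.Sigma) auto
    also have "(SIGMA i:{1..<Suc n}. {i<..<Suc n}) = {(i, j). 1 \<le> i \<and> i < j \<and> j \<le> n}" by auto
    finally show ?thesis unfolding 1 by (simp add: a_def)
  qed
  then show ?thesis
    unfolding HL_P_def HL_def map_permutes_upt[symmetric] sum.reindex[OF inj_on_map_permutes_upt] comp_def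
    by (simp del: upt_Suc)
qed

text \<open>Flags compute the sum, and \<open>chains_full\<close> trades the flag weights for
  tableau weights.\<close>

lemma sum_HL_P:
  "(\<Sum>lam\<in>{lam \<in> partitions_le n. part1 lam \<le> k}. HL_P n x t lam) = chains 0 n k {1..n}"
proof -
  have "(\<Sum>lam\<in>{lam \<in> partitions_le n. part1 lam \<le> k}. HL_P n x t lam) =
    (\<Sum>lam\<in>bounded_parts n k. HL {1..n} lam)"
    unfolding partitions_le_part1 by (intro sum.cong HL_P_eq_HL) (auto simp: bounded_parts_def)
  also have "\<dots> = chains n n k {1..n}"
    by (simp add: chains_eq_sum_HL)
  finally show ?thesis unfolding chains_full[OF order_refl] .
qed

end

subsection \<open>Reduced tableaux\<close>

text \<open>The relation between adjacent columns of a semistandard tableau, a partial order on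
  finite sets.\<close>

definition col_le :: "nat set \<Rightarrow> nat set \<Rightarrow> bool" where
  "col_le C D \<longleftrightarrow> card D \<le> card C \<and>
    (\<forall>i<card D. sorted_list_of_set C ! i \<le> sorted_list_of_set D ! i)"

lemma col_le_refl: "col_le C C"
  by (simp add: col_le_def)

lemma col_le_trans: "col_le C D \<Longrightarrow> col_le D E \<Longrightarrow> col_le C E"
  unfolding col_le_def by (meson le_trans less_le_trans)

lemma col_le_antisym:
  assumes "finite C" "finite D" "col_le C D" "col_le D C"
  shows "C = D"
proof -
  have "sorted_list_of_set C = sorted_list_of_set D"
    using assms(3,4) by (intro nth_equalityI) (auto simp: col_le_def intro: antisym)
  then show ?thesis using assms(1,2) by (metis set_sorted_list_of_set)
qed

text \<open>A row index is the number of smaller entries; this translates between the rows in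
  \<open>Phi\<close> and the counts in \<open>jump\<close>.\<close>

lemma card_less_nth_sorted_list_of_set:
  assumes "i < card C"
  shows "card (C \<inter> {..<sorted_list_of_set C ! i}) = i"
proof -
  let ?L = "sorted_list_of_set C"
  have C: "finite C" using assms card.infinite by fastforce
  have less: "?L ! j < ?L ! i \<longleftrightarrow> j < i" if "j < card C" for j
    using that assms strict_sorted_list_of_set[of C]
    by (metis linorder_neqE_nat not_less_iff_gr_or_eq length_sorted_list_of_set sorted_wrt_nth_less)
  have "C \<inter> {..<?L ! i} = (!) ?L ` {..<i}"
  proof (intro equalityI subsetI)
    fix b assume b: "b \<in> C \<inter> {..<?L ! i}"
    then obtain j where "j < card C" "b = ?L ! j"
      using C by (metis IntD1 in_set_conv_nth length_sorted_list_of_set set_sorted_list_of_set)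
    then show "b \<in> (!) ?L ` {..<i}" using b less by auto
  next
    fix b assume "b \<in> (!) ?L ` {..<i}"
    then obtain j where "j < i" "b = ?L ! j" by auto
    then show "b \<in> C \<inter> {..<?L ! i}"
      using less[of j] assms C by (metis IntI lessThan_iff length_sorted_list_of_set less_trans nth_mem set_sorted_list_of_set)
  qed
  moreover have "inj_on ((!) ?L) {..<i}"
    using assms by (intro inj_on_nth) auto
  ultimately show ?thesis by (simp add: card_image)
qed

lemma nth_sorted_list_of_set_card_less:
  assumes "finite C" "b \<in> C"
  shows "card (C \<inter> {..<b}) < card C" "sorted_list_of_set C ! card (C \<inter> {..<b}) = b"
proof -
  obtain i where i: "i < card C" "b = sorted_list_of_set C ! i"
    using assms by (metis in_set_conv_nth length_sorted_list_of_set set_sorted_list_of_set)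
  then show "card (C \<inter> {..<b}) < card C" "sorted_list_of_set C ! card (C \<inter> {..<b}) = b"
    by (simp_all add: card_less_nth_sorted_list_of_set)
qed

lemma nth_sorted_list_of_set_mem: "i < card C \<Longrightarrow> sorted_list_of_set C ! i \<in> C"
  by (metis card.infinite length_sorted_list_of_set not_less_zero nth_mem set_sorted_list_of_set)

text \<open>Semistandardness means that no initial segment contains more entries of \<open>D\<close>
  than of \<open>C\<close>. At the least \<open>b\<close> for which \<open>{..b}\<close> violates
  this, the count for \<open>D\<close> has just overtaken that for \<open>C\<close>.\<close>

lemma not_col_le_first_violation:
  assumes "finite C" "finite D" "\<not> col_le C D"
  obtains b where "b \<in> D - C" "card (C \<inter> {..<b}) \<le> card (D \<inter> {..<b})"
proof -
  define P where "P b \<longleftrightarrow> card (C \<inter> {..b}) < card (D \<inter> {..b})" for b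
  have atMost: "card (B \<inter> {..b}) = card (B \<inter> {..<b}) + (if b \<in> B then 1 else 0)" for B :: "nat set" and b
  proof -
    have "B \<inter> {..b} = (if b \<in> B then insert b (B \<inter> {..<b}) else B \<inter> {..<b})"
      by (auto simp: order.order_iff_strict)
    then show ?thesis by simp
  qed
  \<comment> \<open>Row \<open>i\<close> is either missing from \<open>C\<close> or has too large an
    entry there; both produce a violation at the entry of \<open>D\<close> in row
    \<open>i\<close>.\<close>
  obtain i where i: "i < card D"
    "card C \<le> i \<or> i < card C \<and> sorted_list_of_set D ! i < sorted_list_of_set C ! i"
    using assms(3) unfolding col_le_def by (metis le_refl less_le_trans not_le)
  let ?b = "sorted_list_of_set D ! i"
  have "card (D \<inter> {..?b}) = Suc i"
    using i(1) by (simp add: atMost card_less_nth_sorted_list_of_set nth_sorted_list_of_set_mem)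
  moreover have "card (C \<inter> {..?b}) \<le> i"
    using i(2)
  proof
    assume "card C \<le> i"
    then show ?thesis using card_mono[OF assms(1), of "C \<inter> {..?b}"] by simp
  next
    assume *: "i < card C \<and> ?b < sorted_list_of_set C ! i"
    then have "card (C \<inter> {..?b}) \<le> card (C \<inter> {..<sorted_list_of_set C ! i})"
      using assms(1) by (intro card_mono) auto
    then show ?thesis using * by (simp add: card_less_nth_sorted_list_of_set)
  qed
  ultimately have "P ?b" by (simp add: P_def)
  define b where "b = (LEAST b. P b)"
  have b: "P b" unfolding b_def using \<open>P ?b\<close> by (rule LeastI)
  \<comment> \<open>By minimality the counts strictly below \<open>b\<close> are still in order, so
    \<open>b\<close> raises only the count for \<open>D\<close>.\<close>
  have "card (D \<inter> {..<b}) \<le> card (C \<inter> {..<b})"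
  proof (cases b)
    case (Suc c)
    then have "\<not> P c" using not_less_Least[of c P] by (simp add: b_def)
    then show ?thesis by (simp add: P_def Suc lessThan_Suc_atMost)
  qed simp
  then have "b \<in> D - C" "card (C \<inter> {..<b}) \<le> card (D \<inter> {..<b})"
    using b by (auto simp: P_def atMost split: if_splits)
  then show thesis by (rule that)
qed

section \<open>Legs and recursion on the first column\<close>

definition leg :: "nat set \<Rightarrow> nat set \<Rightarrow> nat \<Rightarrow> nat set" where
  "leg C D i = (if sorted_list_of_set D ! i \<in> C then {}
    else C \<inter> {sorted_list_of_set C ! i..sorted_list_of_set D ! i})"

lemma SSYT_Cons_Cons:
  "SSYT n (C # D # T) \<longleftrightarrow> C \<noteq> {} \<and> C \<subseteq> {1..n} \<and> col_le C D \<and> SSYT n (D # T)"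
proof -
  have *: "(\<forall>j. P j) \<longleftrightarrow> P 0 \<and> (\<forall>j. P (Suc j))" for P
    by (metis nat.exhaust)
  show ?thesis
    unfolding SSYT_def col_le_def entry_def by (subst *) auto
qed

lemma SSYT_Cons_le: "SSYT n (C # T) \<Longrightarrow> D \<in> set T \<Longrightarrow> col_le C D"
  by (induction T arbitrary: C) (auto simp: SSYT_Cons_Cons intro: col_le_trans)

lemma SSYT_Nil: "SSYT n []"
  by (simp add: SSYT_def)

lemma SSYT_singleton: "SSYT n [C] \<longleftrightarrow> C \<noteq> {} \<and> C \<subseteq> {1..n}"
  by (auto simp: SSYT_def)

lemma SSYT_ConsD: "SSYT n (C # T) \<Longrightarrow> C \<noteq> {} \<and> C \<subseteq> {1..n} \<and> SSYT n T"
  by (cases T) (auto simp: SSYT_Cons_Cons SSYT_Nil SSYT_singleton)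

text \<open>A later repetition of \<open>C\<close> would force \<open>C = D\<close> by antisymmetry
  of \<open>col_le\<close>, so comparing neighbours ensures distinctness.\<close>

lemma rSSYT_Cons_Cons:
  "C # D # T \<in> rSSYT n \<longleftrightarrow>
    C \<noteq> {} \<and> C \<subseteq> {1..n} \<and> C \<noteq> D \<and> col_le C D \<and> D # T \<in> rSSYT n"
proof -
  have "C \<notin> set T" if T: "C \<subseteq> {1..n}" "C \<noteq> D" "col_le C D" "SSYT n (D # T)"
  proof
    assume "C \<in> set T"
    then have "col_le D C" using SSYT_Cons_le[OF T(4)] by blast
    moreover have "finite C" "finite D"
      using T(1) SSYT_ConsD[OF T(4)] by (auto intro: finite_subset)
    ultimately show False using T(2,3) col_le_antisym by blast
  qed
  then show ?thesis by (auto simp: rSSYT_def SSYT_Cons_Cons)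
qed

lemma Phi_Nil: "Phi [] Y = 1"
  by (simp add: Phi_def in_cell_def)

lemma Phi_singleton: "Phi [C] Y = 1"
proof -
  have "LegP [C] i j = {}" for i j by (simp add: LegP_def in_cell_def)
  then show ?thesis by (simp add: Phi_def)
qed

text \<open>A leg involves two adjacent columns only. Column 0 gives the product over the rows of
  \<open>D\<close>, all of which exist in \<open>C\<close> too; the other cells are those of
  \<open>D # T\<close> shifted by one column.\<close>

lemma Phi_Cons_Cons:
  assumes "card D \<le> card C"
  shows "Phi (C # D # T) Y = (\<Prod>i\<in>{i. i < card D \<and> leg C D i \<noteq> {}}. 1 - Y ^ card (leg C D i)) * Phi (D # T) Y"
proof -
  define I where "I T = {(i, j). in_cell T i j \<and> LegP T i j \<noteq> {}}" for T
  have fin: "finite (I T)" for T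
  proof (rule finite_subset)
    show "I T \<subseteq> (SIGMA i:{..<Max (insert 0 (card ` set T))}. {..<length T})"
      by (auto simp: I_def in_cell_def less_le_trans[OF _ Max_ge])
  qed simp
  have Suc: "in_cell (C # T) i (Suc j) = in_cell T i j" "LegP (C # T) i (Suc j) = LegP T i j" for T i j
    by (simp_all add: in_cell_def LegP_def entry_def)
  have 0: "in_cell (C # D # T) i 0 \<and> LegP (C # D # T) i 0 \<noteq> {} \<longleftrightarrow> i < card D \<and> leg C D i \<noteq> {}"
    "i < card D \<Longrightarrow> LegP (C # D # T) i 0 = leg C D i" for i
    using assms by (auto simp: in_cell_def LegP_def entry_def leg_def)
  have "I (C # D # T) = (\<lambda>i. (i, 0)) ` {i. i < card D \<and> leg C D i \<noteq> {}} \<union> (\<lambda>(i, j). (i, Suc j)) ` I (D # T)"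
  proof (intro equalityI subsetI)
    fix p assume p: "p \<in> I (C # D # T)"
    obtain i j where ij: "p = (i, j)" by (cases p)
    show "p \<in> (\<lambda>i. (i, 0)) ` {i. i < card D \<and> leg C D i \<noteq> {}} \<union> (\<lambda>(i, j). (i, Suc j)) ` I (D # T)"
      using p unfolding ij by (cases j) (auto simp: I_def 0 Suc)
  next
    fix p assume "p \<in> (\<lambda>i. (i, 0)) ` {i. i < card D \<and> leg C D i \<noteq> {}} \<union> (\<lambda>(i, j). (i, Suc j)) ` I (D # T)"
    then show "p \<in> I (C # D # T)" using 0 by (auto simp: I_def Suc)
  qed
  then have "Phi (C # D # T) Y =
    (\<Prod>(i, j)\<in>(\<lambda>i. (i, 0)) ` {i. i < card D \<and> leg C D i \<noteq> {}}. 1 - Y ^ card (LegP (C # D # T) i j)) *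
    (\<Prod>(i, j)\<in>(\<lambda>(i, j). (i, Suc j)) ` I (D # T). 1 - Y ^ card (LegP (C # D # T) i j))"
    unfolding Phi_def I_def[symmetric] using fin by (simp only:) (rule prod.union_disjoint, auto)
  also have "(\<Prod>(i, j)\<in>(\<lambda>i. (i, 0)) ` {i. i < card D \<and> leg C D i \<noteq> {}}. 1 - Y ^ card (LegP (C # D # T) i j)) =
    (\<Prod>i\<in>{i. i < card D \<and> leg C D i \<noteq> {}}. 1 - Y ^ card (leg C D i))"
    by (subst prod.reindex) (auto simp: inj_on_def 0 intro!: prod.cong)
  also have "(\<Prod>(i, j)\<in>(\<lambda>(i, j). (i, Suc j)) ` I (D # T). 1 - Y ^ card (LegP (C # D # T) i j)) = Phi (D # T) Y"
    unfolding Phi_def I_def[symmetric]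
    by (subst prod.reindex) (auto simp: inj_on_def Suc intro!: prod.cong)
  finally show ?thesis .
qed

definition col_succ :: "nat \<Rightarrow> nat set \<Rightarrow> nat set set" where
  "col_succ n C = {D \<in> Pow {1..n}. D \<noteq> {} \<and> D \<noteq> C \<and> col_le C D}"

definition followers :: "nat \<Rightarrow> nat set \<Rightarrow> nat set list set" where
  "followers n C = {T. C # T \<in> rSSYT n}"

lemma rSSYT_eq: "rSSYT n = insert [] (\<Union>C\<in>Pow {1..n} - {{}}. (#) C ` followers n C)"
proof -
  have "T \<in> insert [] (\<Union>C\<in>Pow {1..n} - {{}}. (#) C ` followers n C)" if "T \<in> rSSYT n" for T
  proof (cases T)
    case (Cons C T')
    then have "C \<in> Pow {1..n} - {{}}" using that SSYT_ConsD[of n C T'] by (auto simp: rSSYT_def)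
    moreover have "T' \<in> followers n C" using that Cons by (simp add: followers_def)
    ultimately show ?thesis using Cons by blast
  qed simp
  moreover have "[] \<in> rSSYT n" by (simp add: rSSYT_def SSYT_def)
  ultimately show ?thesis by (auto simp: followers_def)
qed

lemma finite_rSSYT: "finite (rSSYT n)"
proof (rule finite_subset)
  show "rSSYT n \<subseteq> {T. set T \<subseteq> Pow {1..n} \<and> length T \<le> card (Pow {1..n})}"
  proof
    fix T assume T: "T \<in> rSSYT n"
    then have "set T \<subseteq> Pow {1..n}" "distinct T" by (auto simp: rSSYT_def SSYT_def)
    then show "T \<in> {T. set T \<subseteq> Pow {1..n} \<and> length T \<le> card (Pow {1..n})}"
      using card_mono[of "Pow {1..n}" "set T"] by (simp add: distinct_card)
  qed
  show "finite {T. set T \<subseteq> Pow {1..n} \<and> length T \<le> card (Pow {1..n})}"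
    by (rule finite_lists_length_le) simp
qed

lemma finite_followers: "finite (followers n C)"
  unfolding followers_def using finite_vimageI[OF finite_rSSYT, of "(#) C"] by (simp add: vimage_def)

lemma followers_eq:
  assumes "C \<subseteq> {1..n}" "C \<noteq> {}"
  shows "followers n C = insert [] (\<Union>D\<in>col_succ n C. (#) D ` followers n D)"
proof -
  have "T \<in> followers n C \<longleftrightarrow> T \<in> insert [] (\<Union>D\<in>col_succ n C. (#) D ` followers n D)" for T
  proof (cases T)
    case Nil
    then show ?thesis using assms by (simp add: followers_def rSSYT_def SSYT_singleton)
  next
    case (Cons D T')
    have "D \<noteq> {} \<and> D \<subseteq> {1..n}" if "D # T' \<in> rSSYT n"
      using that SSYT_ConsD[of n D T'] by (simp add: rSSYT_def)
    then show ?thesis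
      using assms unfolding Cons by (auto simp: followers_def col_succ_def rSSYT_Cons_Cons)
  qed
  then show ?thesis by blast
qed

lemma finite_col_succ: "finite (col_succ n C)"
  by (simp add: col_succ_def)

lemma sum_Cons_Union:
  fixes f :: "'b list \<Rightarrow> 'c::comm_monoid_add"
  assumes "finite I" "\<And>D. D \<in> I \<Longrightarrow> finite (B D)"
  shows "(\<Sum>T\<in>insert [] (\<Union>D\<in>I. (#) D ` B D). f T) = f [] + (\<Sum>D\<in>I. \<Sum>T\<in>B D. f (D # T))"
proof -
  have "(\<Sum>T\<in>(\<Union>D\<in>I. (#) D ` B D). f T) = (\<Sum>D\<in>I. \<Sum>T\<in>(#) D ` B D. f T)"
    using assms by (intro sum.UNION_disjoint) auto
  also have "\<dots> = (\<Sum>D\<in>I. \<Sum>T\<in>B D. f (D # T))"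
    by (rule sum.cong[OF refl], subst sum.reindex) auto
  finally show ?thesis using assms by (subst sum.insert) auto
qed

subsection \<open>Generating functions\<close>

context hall_littlewood
begin

section \<open>Weights of adjacent columns\<close>

definition col_weight :: "nat set \<Rightarrow> nat set \<Rightarrow> 'a" where
  "col_weight C D = jump C D 0"

lemma col_weight_subset: "D \<subseteq> C \<Longrightarrow> col_weight C D = 1"
proof -
  assume "D \<subseteq> C"
  then have "D - C = {}" by auto
  then show ?thesis by (simp only: col_weight_def jump_def prod.empty)
qed

lemma col_weight_eq_0:
  assumes "finite C" "finite D" "\<not> col_le C D"
  shows "col_weight C D = 0"
proof -
  obtain b where b: "b \<in> D - C" "card (C \<inter> {..<b}) \<le> card (D \<inter> {..<b})"
    using assms by (rule not_col_le_first_violation)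
  \<comment> \<open>Truncated subtraction makes the exponent 0, so that the factor is
    \<open>1 - t ^ 0\<close>.\<close>
  then have "1 - t ^ (card (C \<inter> {..<b}) - (0 + card (D \<inter> {..<b}))) = 0" by simp
  then show ?thesis
    unfolding col_weight_def jump_def using assms(2) b(1) by (intro prod_zero) auto
qed

text \<open>Row \<open>i\<close> corresponds to its entry \<open>b\<close> in \<open>D\<close>. The
  leg is nonempty iff \<open>b\<close> is not in \<open>C\<close>, as it then contains the entry of
  \<open>C\<close> in row \<open>i\<close>; it consists of the entries of \<open>C\<close> below
  \<open>b\<close> except the first \<open>i\<close>.\<close>

lemma col_weight_eq_prod_leg:
  assumes "finite C" "finite D" "col_le C D"
  shows "(\<Prod>i\<in>{i. i < card D \<and> leg C D i \<noteq> {}}. 1 - t ^ card (leg C D i)) = col_weight C D"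
proof -
  let ?C = "sorted_list_of_set C" and ?D = "sorted_list_of_set D"
  have i: "i < card C" "?C ! i \<le> ?D ! i" if "i < card D" for i
    using that assms(3) by (auto simp: col_le_def)
  have leg: "leg C D i \<noteq> {} \<longleftrightarrow> ?D ! i \<notin> C" if "i < card D" for i
    using i[OF that] nth_sorted_list_of_set_mem[of i C] by (force simp: leg_def)
  have card: "card (leg C D i) = card (C \<inter> {..<?D ! i}) - i" if "i < card D" "?D ! i \<notin> C" for i
  proof -
    have "b \<noteq> ?D ! i" if "b \<in> C" for b using that \<open>?D ! i \<notin> C\<close> by auto
    then have "leg C D i = C \<inter> {..<?D ! i} - C \<inter> {..<?C ! i}"
      using that(2) by (auto simp: leg_def order.order_iff_strict)
    moreover have "C \<inter> {..<?C ! i} \<subseteq> C \<inter> {..<?D ! i}" using i[OF that(1)] by auto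
    ultimately show ?thesis
      using assms(1) i[OF that(1)] by (simp add: card_Diff_subset card_less_nth_sorted_list_of_set)
  qed
  show ?thesis
    unfolding col_weight_def jump_def
  proof (rule prod.reindex_bij_witness[where i = "\<lambda>b. card (D \<inter> {..<b})" and j = "\<lambda>i. ?D ! i"])
    fix i assume "i \<in> {i. i < card D \<and> leg C D i \<noteq> {}}"
    then have i: "i < card D" "?D ! i \<notin> C" using leg by auto
    then show "card (D \<inter> {..<?D ! i}) = i" "?D ! i \<in> D - C"
      by (simp_all add: card_less_nth_sorted_list_of_set nth_sorted_list_of_set_mem)
    show "1 - t ^ (card (C \<inter> {..<?D ! i}) - (0 + card (D \<inter> {..<?D ! i}))) = 1 - t ^ card (leg C D i)"
      using i by (simp add: card card_less_nth_sorted_list_of_set)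
  next
    fix b assume "b \<in> D - C"
    then show "?D ! card (D \<inter> {..<b}) = b" "card (D \<inter> {..<b}) \<in> {i. i < card D \<and> leg C D i \<noteq> {}}"
      using nth_sorted_list_of_set_card_less[OF assms(2), of b] leg by auto
  qed
qed

lemma fps_const_one_minus_power_prod:
  "(\<Prod>i\<in>I. 1 - fps_const t ^ e i) = fps_const (\<Prod>i\<in>I. 1 - t ^ e i)"
proof (induction I rule: infinite_finite_induct)
  case (insert i I)
  have "1 - fps_const t ^ e i = fps_const (1 - t ^ e i)"
    by (simp flip: fps_const_1_eq_1 fps_const_sub)
  then show ?case using insert by simp
qed simp_all

lemma Phi_Cons_Cons_weight:
  assumes "finite C" "finite D" "col_le C D"
  shows "Phi (C # D # T) (fps_const t) = fps_const (col_weight C D) * Phi (D # T) (fps_const t)"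
proof -
  have "card D \<le> card C" using assms(3) by (simp add: col_le_def)
  then show ?thesis
    by (simp only: Phi_Cons_Cons fps_const_one_minus_power_prod col_weight_eq_prod_leg[OF assms])
qed

section \<open>Series of tableaux and of chains\<close>

definition Xf :: "nat set \<Rightarrow> 'a fps" where
  "Xf C = fps_const (X C) * fps_X"

text \<open>The geometric series of a column repeated at least once.\<close>

definition Zf :: "nat set \<Rightarrow> 'a fps" where
  "Zf C = Xf C * inverse (1 - Xf C)"

lemma Zf_mult: "Zf C * (1 - Xf C) = Xf C"
proof -
  have "inverse (1 - Xf C) * (1 - Xf C) = 1"
    by (rule inverse_mult_eq_1) (simp add: Xf_def)
  then show ?thesis by (simp add: Zf_def mult.assoc)
qed

text \<open>Sums over the continuations of \<open>C\<close>, including the legs of \<open>C\<close>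
  but not its own factor \<open>Zf C\<close>.\<close>

definition tab_series :: "nat \<Rightarrow> nat set \<Rightarrow> 'a fps" where
  "tab_series n C = (\<Sum>T\<in>followers n C. Phi (C # T) (fps_const t) * (\<Prod>D\<in>set T. Zf D))"

text \<open>In contrast to \<open>tab_series\<close>, columns may repeat or be empty, and
  \<open>fps_X\<close> counts all of them.\<close>

definition chain_series :: "nat \<Rightarrow> nat set \<Rightarrow> 'a fps" where
  "chain_series n C = Abs_fps (\<lambda>k. chains 0 n k C)"

lemma prod_set_Cons:
  "T \<in> followers n D \<Longrightarrow> (\<Prod>E\<in>set (D # T). Zf E) = Zf D * (\<Prod>E\<in>set T. Zf E)"
  by (simp add: followers_def rSSYT_def)

text \<open>Recursion on the column right after \<open>C\<close>; the summand 1 stands for ending at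
  \<open>C\<close>.\<close>

lemma tab_series_rec:
  assumes "C \<subseteq> {1..n}" "C \<noteq> {}"
  shows "tab_series n C = 1 + (\<Sum>D\<in>col_succ n C. fps_const (col_weight C D) * Zf D * tab_series n D)"
proof -
  have "tab_series n C = Phi [C] (fps_const t) + (\<Sum>D\<in>col_succ n C. \<Sum>T\<in>followers n D.
      Phi (C # D # T) (fps_const t) * (\<Prod>E\<in>set (D # T). Zf E))"
    unfolding tab_series_def followers_eq[OF assms]
    using finite_col_succ finite_followers by (subst sum_Cons_Union) auto
  also have "\<dots> = 1 + (\<Sum>D\<in>col_succ n C. \<Sum>T\<in>followers n D.
      fps_const (col_weight C D) * Zf D * (Phi (D # T) (fps_const t) * (\<Prod>E\<in>set T. Zf E)))"
    unfolding Phi_singleton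
  proof (intro arg_cong2[where f = "(+)"] sum.cong refl)
    fix D T assume D: "D \<in> col_succ n C" and T: "T \<in> followers n D"
    have "finite C" "finite D" "col_le C D"
      using D assms by (auto simp: col_succ_def intro: finite_subset)
    then show "Phi (C # D # T) (fps_const t) * (\<Prod>E\<in>set (D # T). Zf E) =
      fps_const (col_weight C D) * Zf D * (Phi (D # T) (fps_const t) * (\<Prod>E\<in>set T. Zf E))"
      by (simp only: Phi_Cons_Cons_weight prod_set_Cons[OF T] mult_ac)
  qed
  finally show ?thesis by (simp add: tab_series_def sum_distrib_left)
qed

lemma HLS_eq_tab_series:
  "HLS n (fps_const t) Xf = 1 + (\<Sum>C\<in>Pow {1..n} - {{}}. Zf C * tab_series n C)"
proof -
  have "HLS n (fps_const t) Xf = Phi [] (fps_const t) + (\<Sum>C\<in>Pow {1..n} - {{}}. \<Sum>T\<in>followers n C.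
      Phi (C # T) (fps_const t) * (\<Prod>D\<in>set (C # T). Zf D))"
    unfolding HLS_def Zf_def[symmetric] rSSYT_eq
    using finite_followers by (subst sum_Cons_Union) auto
  also have "\<dots> = 1 + (\<Sum>C\<in>Pow {1..n} - {{}}. \<Sum>T\<in>followers n C.
      Zf C * (Phi (C # T) (fps_const t) * (\<Prod>D\<in>set T. Zf D)))"
    unfolding Phi_Nil
    by (intro arg_cong2[where f = "(+)"] sum.cong refl) (simp only: prod_set_Cons mult_ac)
  finally show ?thesis by (simp add: tab_series_def sum_distrib_left)
qed

lemma chain_series_rec:
  assumes "C \<subseteq> {1..n}"
  shows "chain_series n C = 1 + (\<Sum>D\<in>Pow {1..n}. fps_const (col_weight C D) * Xf D * chain_series n D)"
proof -
  have K: "kernel 0 C D = col_weight C D" if "D \<subseteq> {1..n}" for D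
  proof -
    \<comment> \<open>Entries start at 1, so at \<open>m = 0\<close> none of them is subject to the
      flag rule.\<close>
    have "D \<inter> {..0} = {}" "D \<inter> {0<..} = D" using that by auto
    then show ?thesis by (simp add: kernel_def col_weight_def)
  qed
  have "chain_series n C = 1 + fps_X * (\<Sum>D\<in>Pow {1..n}. fps_const (col_weight C D * X D) * chain_series n D)"
  proof (rule fps_ext)
    fix k
    show "fps_nth (chain_series n C) k =
      fps_nth (1 + fps_X * (\<Sum>D\<in>Pow {1..n}. fps_const (col_weight C D * X D) * chain_series n D)) k"
    proof (cases k)
      case (Suc l)
      have "fps_nth (chain_series n C) (Suc l) = (\<Sum>D\<in>Pow {1..n}. col_weight C D * (X D * chains 0 n l D))"
        unfolding chain_series_def fps_nth_Abs_fps chains.simps transfer_def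
        by (intro sum.cong) (simp_all add: K)
      then show ?thesis by (simp add: Suc fps_sum_nth chain_series_def mult.assoc)
    qed (simp add: chain_series_def)
  qed
  also have "\<dots> = 1 + (\<Sum>D\<in>Pow {1..n}. fps_const (col_weight C D) * Xf D * chain_series n D)"
    by (simp add: sum_distrib_left Xf_def mult_ac flip: fps_const_mult)
  finally show ?thesis .
qed

text \<open>Only the empty column can follow the empty one, with weight 1, so the series is
  geometric.\<close>

lemma chain_series_empty: "(1 - fps_X) * chain_series n {} = 1"
proof -
  have "col_weight {} D = 0" if "D \<in> Pow {1..n} - {{}}" for D
  proof (rule col_weight_eq_0)
    show "finite D" using that by (auto intro: finite_subset)
    then show "\<not> col_le {} D" using that by (auto simp: col_le_def)
  qed simp
  then have "(\<Sum>D\<in>Pow {1..n}. fps_const (col_weight {} D) * Xf D * chain_series n D) =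
    (\<Sum>D\<in>{{}}. fps_const (col_weight {} D) * Xf D * chain_series n D)"
    by (intro sum.mono_neutral_right) auto
  also have "\<dots> = fps_X * chain_series n {}"
    by (simp add: col_weight_subset Xf_def X_def)
  finally have eq: "chain_series n {} = 1 + fps_X * chain_series n {}"
    using chain_series_rec[of "{}" n] by simp
  show ?thesis
    unfolding left_diff_distrib mult_1_left diff_eq_eq by (rule eq)
qed

text \<open>The term \<open>D = C\<close> has weight 1 and moves to the left as
  \<open>1 - Xf C\<close>. The summand 1 and the term of the empty column add up to the geometric
  series, which \<open>1 - fps_X\<close> turns into 1.\<close>

lemma chain_series_rec':
  assumes "C \<subseteq> {1..n}" "C \<noteq> {}"
  shows "(1 - fps_X) * (1 - Xf C) * chain_series n C =
    1 + (\<Sum>D\<in>col_succ n C. fps_const (col_weight C D) * Xf D * ((1 - fps_X) * chain_series n D))"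
proof -
  let ?f = "\<lambda>D. fps_const (col_weight C D) * Xf D * chain_series n D"
  have C: "finite C" using assms(1) by (rule finite_subset) simp
  have "(\<Sum>D\<in>Pow {1..n}. ?f D) = (\<Sum>D\<in>insert {} (insert C (col_succ n C)). ?f D)"
  proof (rule sum.mono_neutral_right)
    show "\<forall>D\<in>Pow {1..n} - insert {} (insert C (col_succ n C)). ?f D = 0"
    proof
      fix D assume D: "D \<in> Pow {1..n} - insert {} (insert C (col_succ n C))"
      then have "finite D" "\<not> col_le C D" by (auto simp: col_succ_def intro: finite_subset)
      then show "?f D = 0" using C by (simp add: col_weight_eq_0)
    qed
  qed (use assms in \<open>auto simp: col_succ_def\<close>)
  also have "\<dots> = ?f {} + (?f C + (\<Sum>D\<in>col_succ n C. ?f D))"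
    using assms(2) finite_col_succ by (subst sum.insert; simp add: col_succ_def)+
  also have "?f {} = fps_X * chain_series n {}"
    by (simp add: col_weight_subset Xf_def X_def)
  also have "?f C = Xf C * chain_series n C"
    by (simp add: col_weight_subset)
  finally have sum: "(\<Sum>D\<in>Pow {1..n}. ?f D) =
    fps_X * chain_series n {} + (Xf C * chain_series n C + (\<Sum>D\<in>col_succ n C. ?f D))" .
  have eq: "chain_series n C =
    1 + (fps_X * chain_series n {} + (Xf C * chain_series n C + (\<Sum>D\<in>col_succ n C. ?f D)))"
    using chain_series_rec[OF assms(1)] unfolding sum .
  have "(1 - Xf C) * chain_series n C = 1 + fps_X * chain_series n {} + (\<Sum>D\<in>col_succ n C. ?f D)"
    unfolding left_diff_distrib mult_1_left diff_eq_eq by (rule trans[OF eq]) (simp only: ac_simps)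
  then have "(1 - fps_X) * (1 - Xf C) * chain_series n C =
    (1 - fps_X) + fps_X * ((1 - fps_X) * chain_series n {}) + (1 - fps_X) * (\<Sum>D\<in>col_succ n C. ?f D)"
    unfolding mult.assoc by (simp only: distrib_left mult.left_commute[of _ fps_X] mult_1_right)
  also have "\<dots> = 1 + (1 - fps_X) * (\<Sum>D\<in>col_succ n C. ?f D)"
    by (simp add: chain_series_empty)
  finally show ?thesis
    by (simp add: sum_distrib_left mult_ac)
qed

text \<open>Since \<open>Zf D * (1 - Xf D) = Xf D\<close>, both sides satisfy the same recursion
  over \<open>col_succ n C\<close>. The induction measure drops because \<open>C\<close> itself is
  no longer reachable from a strict successor.\<close>

lemma tab_series_eq_chain_series:
  assumes "C \<subseteq> {1..n}" "C \<noteq> {}"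
  shows "tab_series n C = (1 - fps_X) * (1 - Xf C) * chain_series n C"
  using assms
proof (induction "card {D \<in> Pow {1..n}. col_le C D}" arbitrary: C rule: less_induct)
  case less
  have "fps_const (col_weight C D) * Zf D * tab_series n D =
    fps_const (col_weight C D) * Xf D * ((1 - fps_X) * chain_series n D)" if D: "D \<in> col_succ n C" for D
  proof -
    have sub: "D \<subseteq> {1..n}" "D \<noteq> {}" "D \<noteq> C" "col_le C D" using D by (auto simp: col_succ_def)
    then have "finite C" "finite D" using less.prems by (auto intro: finite_subset)
    then have "\<not> col_le D C" using sub col_le_antisym by blast
    moreover have "{E \<in> Pow {1..n}. col_le D E} \<subseteq> {E \<in> Pow {1..n}. col_le C E}"
      using col_le_trans[OF sub(4)] by auto
    moreover have "C \<in> {E \<in> Pow {1..n}. col_le C E}"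
      using less.prems col_le_refl by simp
    ultimately have "{E \<in> Pow {1..n}. col_le D E} \<subset> {E \<in> Pow {1..n}. col_le C E}"
      by blast
    then have "card {E \<in> Pow {1..n}. col_le D E} < card {E \<in> Pow {1..n}. col_le C E}"
      by (rule psubset_card_mono[rotated]) simp
    then have "tab_series n D = (1 - fps_X) * (1 - Xf D) * chain_series n D"
      using sub by (intro less.hyps)
    then have "fps_const (col_weight C D) * Zf D * tab_series n D =
      fps_const (col_weight C D) * (Zf D * (1 - Xf D)) * ((1 - fps_X) * chain_series n D)"
      by (simp only: mult_ac)
    then show ?thesis by (simp only: Zf_mult)
  qed
  then show ?case
    unfolding tab_series_rec[OF less.prems] chain_series_rec'[OF less.prems]
    by (intro arg_cong2[where f = "(+)"] sum.cong refl)
qed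

text \<open>Every column is a subset of \<open>{1..n}\<close>, so \<open>{1..n}\<close> as a virtual
  column in front imposes no condition and gives weight 1. The factor \<open>1 - fps_X\<close> again
  removes the empty columns.\<close>

lemma HLS_eq_chain_series: "HLS n (fps_const t) Xf = (1 - fps_X) * chain_series n {1..n}"
proof -
  let ?f = "\<lambda>D. Xf D * chain_series n D"
  have "chain_series n {1..n} = 1 + (\<Sum>D\<in>Pow {1..n}. ?f D)"
    unfolding chain_series_rec[OF order_refl, of n]
    by (intro arg_cong2[where f = "(+)"] sum.cong refl) (simp add: col_weight_subset)
  also have "(\<Sum>D\<in>Pow {1..n}. ?f D) = ?f {} + (\<Sum>D\<in>Pow {1..n} - {{}}. ?f D)"
    by (rule sum.remove) auto
  also have "?f {} = fps_X * chain_series n {}"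
    by (simp add: Xf_def X_def)
  finally have "(1 - fps_X) * chain_series n {1..n} = (1 - fps_X) +
    fps_X * ((1 - fps_X) * chain_series n {}) + (\<Sum>D\<in>Pow {1..n} - {{}}. (1 - fps_X) * ?f D)"
    by (simp only: distrib_left mult_1_right mult.left_commute[of "1 - fps_X" fps_X] add.assoc sum_distrib_left)
  also have "\<dots> = 1 + (\<Sum>D\<in>Pow {1..n} - {{}}. (1 - fps_X) * ?f D)"
    by (simp add: chain_series_empty)
  also have "\<dots> = 1 + (\<Sum>D\<in>Pow {1..n} - {{}}. Zf D * tab_series n D)"
  proof (intro arg_cong2[where f = "(+)"] sum.cong refl)
    fix D assume "D \<in> Pow {1..n} - {{}}"
    then have "Zf D * tab_series n D = (Zf D * (1 - Xf D)) * ((1 - fps_X) * chain_series n D)"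
      by (simp only: tab_series_eq_chain_series Diff_iff Pow_iff singleton_iff mult_ac simp_thms)
    then show "(1 - fps_X) * ?f D = Zf D * tab_series n D"
      by (simp only: Zf_mult mult_ac)
  qed
  finally show ?thesis by (simp only: HLS_eq_tab_series)
qed

text \<open>Multiplication by \<open>1 - fps_X\<close> takes differences of the sums over
  \<open>part1 lam \<le> k\<close>, leaving those over \<open>part1 lam = k\<close>.\<close>

theorem sum_HL_P_eq_HLS:
  "Abs_fps (\<lambda>k. \<Sum>lam\<in>{lam \<in> partitions_le n. part1 lam = k}. HL_P n x t lam) =
    HLS n (fps_const t) (\<lambda>C. fps_const (\<Prod>i\<in>C. x i) * fps_X)"
proof -
  define h where "h k = (\<Sum>lam\<in>{lam \<in> partitions_le n. part1 lam = k}. HL_P n x t lam)" for k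
  have Suc: "chains 0 n (Suc k) {1..n} = chains 0 n k {1..n} + h (Suc k)" for k
  proof -
    have "finite {lam \<in> partitions_le n. part1 lam \<le> Suc k}"
      unfolding partitions_le_part1 by simp
    moreover have "{lam \<in> partitions_le n. part1 lam \<le> Suc k} =
      {lam \<in> partitions_le n. part1 lam \<le> k} \<union> {lam \<in> partitions_le n. part1 lam = Suc k}"
      by auto
    ultimately show ?thesis
      unfolding sum_HL_P[symmetric] h_def by (auto intro!: sum.union_disjoint)
  qed
  have 0: "chains 0 n 0 {1..n} = h 0"
    unfolding sum_HL_P[symmetric] h_def by simp
  have "Abs_fps h = (1 - fps_X) * chain_series n {1..n}"
  proof (rule fps_ext)
    fix k
    show "fps_nth (Abs_fps h) k = fps_nth ((1 - fps_X) * chain_series n {1..n}) k"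
      using 0 Suc by (cases k) (simp_all add: chain_series_def left_diff_distrib del: chains.simps)
  qed
  also have "\<dots> = HLS n (fps_const t) Xf"
    by (rule HLS_eq_chain_series[symmetric])
  finally show ?thesis by (simp add: h_def[abs_def] Xf_def[abs_def] X_def)
qed

end

subsection \<open>Specialisation to rational functions\<close>

lemma mvar_power: "mvar k ^ i = Poly_Mapping.single (Poly_Mapping.single k i) 1"
  by (induction i) (simp_all add: mvar_def mult_single single_add[symmetric])

lemma single_one_eq_iff:
  "Poly_Mapping.single u (1::int) = Poly_Mapping.single v 1 \<longleftrightarrow> u = v"
  by (metis keys_single singleton_inject zero_neq_one)

lemma single_exponent_eq_iff:
  "Poly_Mapping.single i (1::nat) = Poly_Mapping.single j 1 \<longleftrightarrow> i = j"
  by (metis keys_single singleton_inject zero_neq_one)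

text \<open>Index 0 is included, and \<open>xv 0\<close> is \<open>Yv\<close> itself. All four
  conditions come down to comparing monomials.\<close>

interpretation xv: hall_littlewood xv Yv
proof
  show "inj xv"
    by (rule injI) (simp add: xv_def eq_fract mvar_def single_one_eq_iff single_exponent_eq_iff del: One_nat_def)
  show "xv i \<noteq> Yv * xv j" for i j
  proof
    assume "xv i = Yv * xv j"
    then have "mvar i = mvar 0 * mvar j" by (simp add: xv_def Yv_def eq_fract)
    then have eq: "Poly_Mapping.single i (1::nat) = Poly_Mapping.single 0 1 + Poly_Mapping.single j 1"
      by (simp add: mvar_def mult_single single_one_eq_iff)
    have "Poly_Mapping.lookup (Poly_Mapping.single i (1::nat)) k =
        Poly_Mapping.lookup (Poly_Mapping.single 0 1) k + Poly_Mapping.lookup (Poly_Mapping.single j 1) k" for k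
      unfolding eq by (simp add: Poly_Mapping.lookup_add)
    \<comment> \<open>The two monomials have degrees 1 and 2, so their exponents at
      \<open>i\<close>, \<open>0\<close> and \<open>j\<close> cannot all agree.\<close>
    from this[of i] this[of 0] this[of j] show False
      by (auto simp: Poly_Mapping.lookup_single when_def split: if_splits)
  qed
  show "Yv \<noteq> 0"
    by (simp add: Yv_def Zero_fract_def eq_fract mvar_def)
  show "Yv ^ i \<noteq> 1" if "0 < i" for i
  proof
    assume "Yv ^ i = 1"
    moreover have "Yv ^ i = Fraction_Field.Fract (mvar 0 ^ i) 1"
      by (induction i) (simp_all add: Yv_def One_fract_def)
    ultimately have "mvar 0 ^ i = 1" by (simp add: One_fract_def eq_fract)
    have "Poly_Mapping.single (Poly_Mapping.single (0::nat) i) (1::int) = Poly_Mapping.single 0 1"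
      using \<open>mvar 0 ^ i = 1\<close> by (simp only: mvar_power single_one)
    then have "Poly_Mapping.lookup (Poly_Mapping.single (0::nat) i) 0 = 0"
      unfolding single_one_eq_iff by simp
    then show False using that by simp
  qed
qed

theorem theoremE:
  fixes n :: nat
  shows "H_series n * (1 - fps_X) =
         HLS n (fps_const Yv) (\<lambda>C. fps_const (xC C) * fps_X)"
proof -
  have inv: "inverse (1 - fps_X :: ratfun fps) * (1 - fps_X) = 1"
    by (rule inverse_mult_eq_1) simp
  have "H_series n * (1 - fps_X) =
    (inverse (1 - fps_X) * (1 - fps_X)) *
    Abs_fps (\<lambda>k. \<Sum>lam\<in>{lam \<in> partitions_le n. part1 lam = k}. HL_P n xv Yv lam)"
    by (simp only: H_series_def mult_ac)
  then show ?thesis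
    unfolding inv by (simp add: xv.sum_HL_P_eq_HLS xC_def)
qed

end
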